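(* Let $G$ be a finite simple graph with independence polynomial $I_G(z)=1+a_1z+a_2z^2+a_3z^3$ (with $a_3\ge 1$), and let $P_G(z)=I_G(z)-1$. Then $\mathcal{A}(G)$ is the disjoint union of $\mathcal{J}(P_G)$ and $\bigcup_{k\ge1}\mathrm{Roots}(I_{G^k})$ if and only if $a_1\ge 3$, $a_2=2a_1-3$ and $a_3=a_1-2$. In all other cases, $\mathcal{A}(G)=\mathcal{J}(P_G)$.
   Context: An independent set in a simple graph $G$ is a set of pairwise non-adjacent vertices. The independence polynomial is $I_G(z)=\sum_{i=0}^{d}a_iz^i$ with $a_0=1$, where $a_i$ is the number of independent sets with exactly $i$ elements and $d$ is the largest size of an independent set. The lexicographic product of $G$ with itself has vertex set $V(G)\times V(G)$, with $(a,x)$ adjacent to $(b,y)$ iff $a$ is adjacent to $b$ in $G$, or $a=b$ and $x$ is adjacent to $y$ in $G$; $G^m$ denotes the $m$-fold lexicographic product of $G$ with itself. For a polynomial $f$, $\mathrm{Roots}(f)=\{z: f(z)=0\}$. The independence attractor is $\mathcal{A}(G)=\lim_{m\to\infty}\mathrm{Roots}(I_{G^m})$ in the Hausdorff metric on compact subsets of $\mathbb{C}$. For a polynomial $f$ of degree at least two, the filled-in Julia set is $K(f)=\{z:\{f^n(z)\}_{n>0}\text{ is bounded}\}$ and the Julia set $\mathcal{J}(f)$ is the boundary of $K(f)$.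
   Formalization: The equivalence is stated only for graphs with at least one edge; this excludes just three isolated vertices, where a1=3, a2=3, a3=1 satisfy the condition but A(G)={-1} while J(P_G) is the circle |z+1|=1, so the claim fails. *)

theory Defs
  imports
    "HOL-Analysis.Analysis"
    "HOL-Computational_Algebra.Polynomial"
    "Graph_Theory.Pair_Digraph"
begin

text \<open>
  A finite simple graph is a \<^locale>\<open>pair_graph\<close>: finite, loop-free, and with a symmetric set of arcs,
  so that \<open>x\<close> and \<open>y\<close> are adjacent iff \<open>(x, y) \<in> parcs G\<close>.
\<close>

definition independent_set :: "'a pair_pre_digraph \<Rightarrow> 'a set \<Rightarrow> bool" where
  "independent_set G S \<longleftrightarrow> S \<subseteq> pverts G \<and> (\<forall>x\<in>S. \<forall>y\<in>S. (x, y) \<notin> parcs G)"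

definition num_independent_sets :: "'a pair_pre_digraph \<Rightarrow> nat \<Rightarrow> nat" where
  "num_independent_sets G i = card {S. independent_set G S \<and> card S = i}"

definition independence_number :: "'a pair_pre_digraph \<Rightarrow> nat" where
  "independence_number G = Max (card ` {S. independent_set G S})"

definition independence_poly :: "'a pair_pre_digraph \<Rightarrow> complex poly" where
  "independence_poly G =
     (\<Sum>i\<le>independence_number G. monom (of_nat (num_independent_sets G i)) i)"

definition lex_prod_graph ::
    "'a pair_pre_digraph \<Rightarrow> 'b pair_pre_digraph \<Rightarrow> ('a \<times> 'b) pair_pre_digraph" where
  "lex_prod_graph G H =
     \<lparr> pverts = pverts G \<times> pverts H,
       parcs = {((a, x), (b, y)). a \<in> pverts G \<and> b \<in> pverts G \<and> x \<in> pverts H \<and> y \<in> pverts H \<and>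
                  ((a, b) \<in> parcs G \<or> a = b \<and> (x, y) \<in> parcs H)} \<rparr>"

definition map_graph :: "('a \<Rightarrow> 'b) \<Rightarrow> 'a pair_pre_digraph \<Rightarrow> 'b pair_pre_digraph" where
  "map_graph f G = \<lparr> pverts = f ` pverts G, parcs = map_prod f f ` parcs G \<rparr>"

text \<open>
  So that all powers have one type, a vertex \<open>(a\<^sub>1, (a\<^sub>2, \<dots>))\<close> of the \<open>m\<close>-fold product is written as the
  list \<open>[a\<^sub>1, a\<^sub>2, \<dots>]\<close> of length \<open>m\<close>. The power \<open>0\<close> is the one-vertex graph, the neutral element of the
  lexicographic product (which is associative up to isomorphism), and the power \<open>1\<close> is a copy of \<open>G\<close>.
\<close>

fun lex_power :: "'a pair_pre_digraph \<Rightarrow> nat \<Rightarrow> 'a list pair_pre_digraph" where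
  "lex_power G 0 = \<lparr> pverts = {[]}, parcs = {} \<rparr>"
| "lex_power G (Suc m) = map_graph (\<lambda>(a, x). a # x) (lex_prod_graph G (lex_power G m))"

definition roots :: "complex poly \<Rightarrow> complex set" where
  "roots f = {z. poly f z = 0}"

definition hausdorff_dist :: "'a::metric_space set \<Rightarrow> 'a set \<Rightarrow> real" where
  "hausdorff_dist A B = max (SUP x\<in>A. infdist x B) (SUP y\<in>B. infdist y A)"

text \<open>
  The Hausdorff metric lives on nonempty compact sets; outside them \<^const>\<open>hausdorff_dist\<close> has no meaning.
\<close>

definition hausdorff_limit :: "(nat \<Rightarrow> 'a::metric_space set) \<Rightarrow> 'a set \<Rightarrow> bool" where
  "hausdorff_limit X A \<longleftrightarrow>
     (\<forall>\<^sub>F m in sequentially. compact (X m) \<and> X m \<noteq> {}) \<and> compact A \<and> A \<noteq> {} \<and>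
     (\<lambda>m. hausdorff_dist (X m) A) \<longlonglongrightarrow> 0"

definition independence_attractor :: "'a pair_pre_digraph \<Rightarrow> complex set" where
  "independence_attractor G =
     (THE A. hausdorff_limit (\<lambda>m. roots (independence_poly (lex_power G m))) A)"

definition filled_julia_set :: "complex poly \<Rightarrow> complex set" where
  "filled_julia_set f = {z. bounded ((\<lambda>n. (poly f ^^ n) z) ` {0<..})}"

definition julia_set :: "complex poly \<Rightarrow> complex set" where
  "julia_set f = frontier (filled_julia_set f)"

text \<open>
  Pitfall: the edgeless graph on three vertices has \<open>I\<^sub>G(z) = (1 + z)\<^sup>3\<close>, and all of its lexicographic
  powers are edgeless. The independence polynomial of each power then has \<open>-1\<close> as its only root, so the attractor is \<open>{-1}\<close>,
  whereas the Julia set of \<open>I\<^sub>G - 1\<close> is the unit circle around \<open>-1\<close>. A description of the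
  attractor as a set containing the Julia set therefore has to exclude this graph.
\<close>

end

theory Submission
  imports
    Defs
    "HOL-Computational_Algebra.Fundamental_Theorem_Algebra"
    "HOL-Complex_Analysis.Great_Picard"
begin

text \<open>
  Since \<open>I\<^bsub>G[H]\<^esub>(z) = I\<^sub>G(I\<^sub>H(z) - 1)\<close>, the roots of the \<open>m\<close>-th power are the preimages of \<open>-1\<close> under the
  \<open>m\<close>-th iterate of \<open>P = I\<^sub>G - 1\<close>. By Schottky's theorem these approach every point of the Julia set,
  unless \<open>P(z) = (z + 1)\<^sup>3 - 1\<close>, so the question is whether they also accumulate in the interior of the
  filled-in Julia set \<open>K\<close>. That requires \<open>-1\<close> to be interior to \<open>K\<close>. Then its orbit is a bounded sequence
  of integers, hence ends in a cycle, whose multiplier is an integer; by Cauchy's estimates the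
  multiplier of a cycle in the interior of \<open>K\<close> is neither of modulus greater than 1 nor a root of unity,
  so the cycle is superattracting. If \<open>-1\<close> is not on the cycle, its preimages leave every compact subset
  of the interior. If it is, then \<open>n\<close> divides \<open>P(n)\<close> for every integer \<open>n\<close>, and the positivity of the
  coefficients forces \<open>P(-1) = -1\<close>; together with \<open>P'(-1) = 0\<close> these are the stated equations for \<open>a\<^sub>2\<close>
  and \<open>a\<^sub>3\<close>. In that case the preimages increase with \<open>m\<close> and are isolated in the interior.
\<close>

section \<open>Hausdorff limits\<close>

lemma bdd_above_infdist_image:
  assumes "compact X" shows "bdd_above ((\<lambda>x. infdist x A) ` X)"
  using assms
  by (intro bounded_imp_bdd_above compact_imp_bounded compact_continuous_image continuous_intros)

lemma infdist_le_hausdorff_dist: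
  assumes "compact X" "compact A"
  shows "x \<in> X \<Longrightarrow> infdist x A \<le> hausdorff_dist X A" "y \<in> A \<Longrightarrow> infdist y X \<le> hausdorff_dist X A"
  unfolding hausdorff_dist_def
  using cSUP_upper[OF _ bdd_above_infdist_image[OF assms(1)], of x A]
    cSUP_upper[OF _ bdd_above_infdist_image[OF assms(2)], of y X] by auto

lemma hausdorff_dist_le:
  assumes "X \<noteq> {}" "A \<noteq> {}" "\<And>x. x \<in> X \<Longrightarrow> infdist x A \<le> e" "\<And>y. y \<in> A \<Longrightarrow> infdist y X \<le> e"
  shows "hausdorff_dist X A \<le> e"
  unfolding hausdorff_dist_def using assms by (simp add: cSUP_least)

lemma hausdorff_dist_nonneg:
  assumes "compact X" "compact A" "X \<noteq> {}" shows "0 \<le> hausdorff_dist X A"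
  using assms infdist_le_hausdorff_dist(1)[OF assms(1,2)] infdist_nonneg order_trans by blast

text \<open>A point of \<open>A\<close> has a nearest point in \<open>X m\<close>, which is close to
  \<open>B\<close>; in the limit its distance to the closed set \<open>B\<close> vanishes.\<close>

lemma hausdorff_limit_subset:
  fixes A :: "'a::heine_borel set"
  assumes "hausdorff_limit X A" "hausdorff_limit X B"
  shows "A \<subseteq> B"
proof
  fix z assume z: "z \<in> A"
  have cA: "compact A" and cB: "compact B" "B \<noteq> {}"
    using assms by (auto simp: hausdorff_limit_def)
  have ev: "\<forall>\<^sub>F m in sequentially. infdist z B \<le> hausdorff_dist (X m) A + hausdorff_dist (X m) B"
    using assms(1)[unfolded hausdorff_limit_def, THEN conjunct1]
  proof eventually_elim
    case (elim m)
    then obtain x where x: "x \<in> X m" "infdist z (X m) = dist z x"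
      using infdist_attains_inf[of "X m" z] compact_imp_closed by blast
    have "infdist z B \<le> infdist x B + dist z x" by (rule infdist_triangle)
    moreover have "infdist x B \<le> hausdorff_dist (X m) B"
      using infdist_le_hausdorff_dist(1) elim cB x by blast
    moreover have "infdist z (X m) \<le> hausdorff_dist (X m) A"
      using infdist_le_hausdorff_dist(2) elim cA z by blast
    ultimately show ?case using x by simp
  qed
  have "(\<lambda>m. hausdorff_dist (X m) A + hausdorff_dist (X m) B) \<longlonglongrightarrow> 0 + 0"
    using assms by (intro tendsto_add) (auto simp: hausdorff_limit_def)
  then have "infdist z B \<le> 0 + 0"
    by (rule tendsto_lowerbound) (use ev in auto)
  then have "infdist z B = 0" using infdist_nonneg[of z B] by simp
  then show "z \<in> B"
    using in_closed_iff_infdist_zero[of B z] cB compact_imp_closed by blast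
qed

lemma hausdorff_limit_unique:
  fixes A :: "'a::heine_borel set"
  shows "hausdorff_limit X A \<Longrightarrow> hausdorff_limit X B \<Longrightarrow> A = B"
  by (intro equalityI hausdorff_limit_subset)

lemma the_hausdorff_limit:
  fixes A :: "'a::heine_borel set"
  shows "hausdorff_limit X A \<Longrightarrow> (THE B. hausdorff_limit X B) = A"
  by (intro the_equality) (auto dest: hausdorff_limit_unique)

text \<open>Compactness makes the two pointwise conditions uniform: finitely many neighbourhoods
  from \<open>away\<close> cover the part of \<open>B\<close> at distance at least \<open>e\<close>
  from \<open>A\<close>, and finitely many balls of radius \<open>e/2\<close> cover
  \<open>A\<close>.\<close>

lemma hausdorff_limitI:
  fixes A B :: "'a::metric_space set"
  assumes B: "compact B" and X: "\<And>m. X m \<subseteq> B" "\<And>m. closed (X m)" "\<And>m. X m \<noteq> {}"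
    and A: "A \<subseteq> B" "closed A" "A \<noteq> {}"
    and away: "\<And>z. z \<in> B \<Longrightarrow> z \<notin> A \<Longrightarrow> \<exists>N. open N \<and> z \<in> N \<and> (\<forall>\<^sub>F m in sequentially. X m \<inter> N = {})"
    and near: "\<And>z e. z \<in> A \<Longrightarrow> e > 0 \<Longrightarrow> \<forall>\<^sub>F m in sequentially. X m \<inter> ball z e \<noteq> {}"
  shows "hausdorff_limit X A"
proof -
  have cX: "compact (X m)" for m
    using compact_Int_closed[OF B X(2)[of m]] X(1)[of m] by (simp add: inf.absorb2)
  have cA: "compact A"
    using compact_Int_closed[OF B A(2)] A(1) by (simp add: inf.absorb2)
  have "\<forall>\<^sub>F m in sequentially. hausdorff_dist (X m) A \<le> e" if e: "e > 0" for e
  proof -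
    define D where "D = B \<inter> {z. e \<le> infdist z A}"
    have "closed {z. e \<le> infdist z A}"
      by (intro closed_Collect_le continuous_intros)
    then have cD: "compact D"
      unfolding D_def by (rule compact_Int_closed[OF B])
    have "\<exists>N. open N \<and> z \<in> N \<and> (\<forall>\<^sub>F m in sequentially. X m \<inter> N = {})" if "z \<in> D" for z
      using that e by (intro away) (auto simp: D_def)
    then have "\<exists>N. \<forall>z\<in>D. open (N z) \<and> z \<in> N z \<and> (\<forall>\<^sub>F m in sequentially. X m \<inter> N z = {})"
      by (intro bchoice ballI)
    then obtain N where N: "\<forall>z\<in>D. open (N z)" "\<forall>z\<in>D. z \<in> N z"
        "\<forall>z\<in>D. \<forall>\<^sub>F m in sequentially. X m \<inter> N z = {}"
      by auto
    obtain F where F: "F \<subseteq> D" "finite F" "D \<subseteq> (\<Union>z\<in>F. N z)"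
      by (rule compactE_image[OF cD, of D N]) (use N in auto)
    have ev1: "\<forall>\<^sub>F m in sequentially. \<forall>z\<in>F. X m \<inter> N z = {}"
      using F N by (intro eventually_ball_finite) auto
    obtain F' where F': "F' \<subseteq> A" "finite F'" "A \<subseteq> (\<Union>z\<in>F'. ball z (e/2))"
      by (rule compactE_image[OF cA, of A "\<lambda>z. ball z (e/2)"]) (use e in auto)
    have ev2: "\<forall>\<^sub>F m in sequentially. \<forall>z\<in>F'. X m \<inter> ball z (e/2) \<noteq> {}"
      using F' near e by (intro eventually_ball_finite) auto
    show ?thesis
      using ev1 ev2
    proof eventually_elim
      case (elim m)
      show ?case
      proof (rule hausdorff_dist_le[OF X(3) A(3)])
        fix x assume x: "x \<in> X m"
        then have "x \<notin> D" using elim(1) F(3) by blast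
        then show "infdist x A \<le> e" using x X(1) by (auto simp: D_def)
      next
        fix y assume "y \<in> A"
        then obtain z where z: "z \<in> F'" "dist z y < e/2" using F' by auto
        obtain x where "x \<in> X m \<inter> ball z (e/2)" using elim(2) z(1) by blast
        then have x: "x \<in> X m" "dist z x < e/2" by auto
        have "dist y x \<le> e"
          using z x dist_triangle[of y x z] by (simp add: dist_commute)
        then show "infdist y (X m) \<le> e" using x by (intro infdist_le2)
      qed
    qed
  qed
  note le = this
  have "(\<lambda>m. hausdorff_dist (X m) A) \<longlonglongrightarrow> 0"
  proof (rule tendstoI)
    fix e :: real assume e: "0 < e"
    then have "0 < e/2" by simp
    from le[OF this] show "\<forall>\<^sub>F m in sequentially. dist (hausdorff_dist (X m) A) 0 < e"
    proof eventually_elim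
      case (elim m)
      have "0 \<le> hausdorff_dist (X m) A" by (intro hausdorff_dist_nonneg cX cA X)
      then show ?case using elim e by simp
    qed
  qed
  then show ?thesis
    unfolding hausdorff_limit_def using cX X(3) cA A(3) by simp
qed

section \<open>Independence polynomials of lexicographic powers\<close>

lemma poly_independence_poly:
  assumes "finite (pverts G)"
  shows "poly (independence_poly G) z = (\<Sum>S | independent_set G S. z ^ card S)"
proof -
  let ?I = "{S. independent_set G S}"
  have fin: "finite ?I"
    by (rule finite_subset[of _ "Pow (pverts G)"]) (use assms in \<open>auto simp: independent_set_def\<close>)
  have sub: "card ` ?I \<subseteq> {..independence_number G}"
    using fin by (auto simp: independence_number_def)
  have "(\<Sum>S | independent_set G S. z ^ card S)
      = (\<Sum>i\<le>independence_number G. \<Sum>S\<in>{S \<in> ?I. card S = i}. z ^ card S)"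
    by (rule sum.group[symmetric]) (use fin sub in auto)
  also have "\<dots> = (\<Sum>i\<le>independence_number G. of_nat (num_independent_sets G i) * z ^ i)"
    by (rule sum.cong) (auto simp: num_independent_sets_def)
  finally show ?thesis
    by (simp add: independence_poly_def poly_sum poly_monom)
qed

lemma independent_set_map_graph:
  assumes "inj f"
  shows "independent_set (map_graph f G) S \<longleftrightarrow> (\<exists>T. independent_set G T \<and> S = f ` T)"
proof -
  have "(f x, f y) \<in> map_prod f f ` parcs G \<longleftrightarrow> (x, y) \<in> parcs G" for x y
    using assms by (auto simp: image_iff map_prod_def inj_eq split: prod.splits intro!: bexI[of _ "(x, y)"])
  then have "independent_set (map_graph f G) (f ` T) \<longleftrightarrow> independent_set G T" for T
    using assms by (simp add: independent_set_def map_graph_def inj_image_subset_iff)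
  moreover have "\<exists>T. S = f ` T" if "independent_set (map_graph f G) S"
    using that by (auto simp: independent_set_def map_graph_def subset_image_iff)
  ultimately show ?thesis by auto
qed

text \<open>Carries the polynomial over the renaming of pairs to lists in
  \<open>lex_power\<close>.\<close>

lemma poly_independence_poly_map_graph:
  assumes "finite (pverts G)" "inj f"
  shows "poly (independence_poly (map_graph f G)) z = poly (independence_poly G) z"
proof -
  have "{S. independent_set (map_graph f G) S} = (`) f ` {S. independent_set G S}"
    using independent_set_map_graph[OF assms(2)] by auto
  moreover have "inj_on ((`) f) {S. independent_set G S}"
    using assms(2) by (meson inj_image_eq_iff inj_onI)
  moreover have "card (f ` S) = card S" for S
    using assms(2) by (meson card_image inj_on_subset subset_UNIV)
  ultimately show ?thesis
    using assms by (simp add: poly_independence_poly map_graph_def[of f G, THEN arg_cong[where f=pverts]]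
        sum.reindex)
qed

lemma independent_set_lex_prod_graph:
  "independent_set (lex_prod_graph G H) S \<longleftrightarrow>
     independent_set G (fst ` S) \<and> (\<forall>a\<in>fst ` S. independent_set H (S `` {a}))"
  (is "?L \<longleftrightarrow> ?R")
proof
  assume ?L
  then have sub: "S \<subseteq> pverts G \<times> pverts H"
    and arcs: "\<forall>p\<in>S. \<forall>q\<in>S. (p, q) \<notin> parcs (lex_prod_graph G H)"
    by (auto simp: independent_set_def lex_prod_graph_def)
  have ind: "(a, b) \<notin> parcs G \<and> \<not> (a = b \<and> (x, y) \<in> parcs H)"
    if "(a, x) \<in> S" "(b, y) \<in> S" for a x b y
  proof -
    have "((a, x), (b, y)) \<notin> parcs (lex_prod_graph G H)"
      using that arcs by blast
    moreover have "a \<in> pverts G" "b \<in> pverts G" "x \<in> pverts H" "y \<in> pverts H"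
      using that sub by auto
    ultimately show ?thesis by (simp add: lex_prod_graph_def)
  qed
  have "independent_set G (fst ` S)"
    unfolding independent_set_def using sub ind by auto
  moreover have "independent_set H (S `` {a})" for a
    unfolding independent_set_def using sub ind[of a _ a] by auto
  ultimately show ?R by simp
next
  assume ?R
  then have G: "fst ` S \<subseteq> pverts G" "\<And>a b. a \<in> fst ` S \<Longrightarrow> b \<in> fst ` S \<Longrightarrow> (a, b) \<notin> parcs G"
    and H: "\<And>a. a \<in> fst ` S \<Longrightarrow> S `` {a} \<subseteq> pverts H"
      "\<And>a x y. a \<in> fst ` S \<Longrightarrow> x \<in> S `` {a} \<Longrightarrow> y \<in> S `` {a} \<Longrightarrow> (x, y) \<notin> parcs H"
    unfolding independent_set_def by blast+
  have fst: "a \<in> fst ` S" if "(a, x) \<in> S" for a x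
    using that by (metis fst_conv image_eqI)
  have "a \<in> pverts G \<and> x \<in> pverts H" if "(a, x) \<in> S" for a x
    using G(1) H(1)[OF fst[OF that]] fst[OF that] that by blast
  moreover have "(a, b) \<notin> parcs G" if "(a, x) \<in> S" "(b, y) \<in> S" for a x b y
    using G(2)[OF fst fst] that by blast
  moreover have "(x, y) \<notin> parcs H" if "(a, x) \<in> S" "(a, y) \<in> S" for a x y
    using H(2)[OF fst] that by blast
  ultimately show ?L
    unfolding independent_set_def lex_prod_graph_def by auto
qed

text \<open>
  An independent set of the product consists of an independent set of \<open>G\<close> together with a nonempty
  independent set of \<open>H\<close> over each of its vertices.
\<close>

lemma poly_independence_poly_lex_prod_graph:
  assumes fG: "finite (pverts G)" and fH: "finite (pverts H)"
  shows "poly (independence_poly (lex_prod_graph G H)) z =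
    poly (independence_poly G) (poly (independence_poly H) z - 1)"
proof -
  let ?NE = "{T. independent_set H T \<and> T \<noteq> {}}"
  have finH: "finite {T. independent_set H T}"
    by (rule finite_subset[of _ "Pow (pverts H)"]) (use fH in \<open>auto simp: independent_set_def\<close>)
  have finG: "finite {A. independent_set G A}"
    by (rule finite_subset[of _ "Pow (pverts G)"]) (use fG in \<open>auto simp: independent_set_def\<close>)
  have finT: "finite T" if "independent_set H T" for T
    using that fH by (auto simp: independent_set_def intro: finite_subset)
  have finA: "finite A" if "independent_set G A" for A
    using that fG by (auto simp: independent_set_def intro: finite_subset)
  have "{T. independent_set H T} = insert {} ?NE"
    by (auto simp: independent_set_def)
  moreover have "finite ?NE" using finH by (rule rev_finite_subset) auto
  \<comment> \<open>Subtracting 1 removes the term of the empty set.\<close>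
  ultimately have H: "poly (independence_poly H) z - 1 = (\<Sum>T\<in>?NE. z ^ card T)"
    using fH by (simp add: poly_independence_poly)
  have "poly (independence_poly G) (poly (independence_poly H) z - 1)
      = (\<Sum>A | independent_set G A. \<Prod>a\<in>A. \<Sum>T\<in>?NE. z ^ card T)"
    using fG by (simp add: poly_independence_poly H)
  also have "\<dots> = (\<Sum>A | independent_set G A. \<Sum>g\<in>A \<rightarrow>\<^sub>E ?NE. \<Prod>a\<in>A. z ^ card (g a))"
    by (intro sum.cong prod_sum_PiE refl) (use finA \<open>finite ?NE\<close> in auto)
  also have "\<dots> = (\<Sum>(A, g)\<in>Sigma {A. independent_set G A} (\<lambda>A. A \<rightarrow>\<^sub>E ?NE). \<Prod>a\<in>A. z ^ card (g a))"
    using finG finA \<open>finite ?NE\<close> by (intro sum.Sigma) (auto intro!: finite_PiE)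
  also have "\<dots> = (\<Sum>S | independent_set (lex_prod_graph G H) S. z ^ card S)"
  \<comment> \<open>Here \<open>g\<close> chooses a fibre over each vertex of \<open>A\<close>. As
    fibres are nonempty, \<open>A\<close> is the first projection of \<open>Sigma A g\<close>;
    \<open>restrict\<close> makes the recovered choice extensional.\<close>
  proof (rule sum.reindex_bij_witness[where
        j = "\<lambda>(A, g). Sigma A g" and i = "\<lambda>S. (fst ` S, restrict (\<lambda>a. S `` {a}) (fst ` S))"], goal_cases)
    case (1 p)
    then obtain A g where p: "p = (A, g)" "independent_set G A" "g \<in> A \<rightarrow>\<^sub>E ?NE" by auto
    then have "fst ` Sigma A g = A" by (auto simp: fst_image_Sigma)
    moreover have "restrict (\<lambda>a. Sigma A g `` {a}) A = g"
      using p by (intro ext) (auto simp: restrict_def PiE_def extensional_def)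
    ultimately show ?case using p by simp
  next
    case (2 p)
    then obtain A g where p: "p = (A, g)" "independent_set G A" "g \<in> A \<rightarrow>\<^sub>E ?NE" by auto
    then have "fst ` Sigma A g = A" by (auto simp: fst_image_Sigma)
    moreover have "independent_set H (Sigma A g `` {a})" if "a \<in> A" for a
    proof -
      have "Sigma A g `` {a} = g a" using that by auto
      then show ?thesis using PiE_mem[OF p(3) that] by simp
    qed
    ultimately have "independent_set (lex_prod_graph G H) (Sigma A g)"
      unfolding independent_set_lex_prod_graph using p(2) by simp
    then show ?case using p(1) by simp
  next
    case (3 S)
    have "(a, x) \<in> Sigma (fst ` S) (restrict (\<lambda>a. S `` {a}) (fst ` S)) \<longleftrightarrow> (a, x) \<in> S" for a x
    proof (cases "a \<in> fst ` S")
      case False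
      then have "(a, x) \<notin> S" by (metis fst_conv image_eqI)
      then show ?thesis using False by simp
    qed simp
    then show ?case by (simp add: set_eq_iff)
  next
    case (4 S)
    then show ?case by (auto simp: independent_set_lex_prod_graph)
  next
    case (5 p)
    then obtain A g where p: "p = (A, g)" "independent_set G A" "g \<in> A \<rightarrow>\<^sub>E ?NE" by auto
    then have "card (Sigma A g) = (\<Sum>a\<in>A. card (g a))"
      by (intro card_SigmaI) (auto intro: finA finT)
    then show ?case using p by (simp add: power_sum)
  qed
  also have "\<dots> = poly (independence_poly (lex_prod_graph G H)) z"
    by (rule poly_independence_poly[symmetric]) (use fG fH in \<open>auto simp: lex_prod_graph_def\<close>)
  finally show ?thesis by simp
qed

lemma finite_pverts_lex_power:
  "finite (pverts G) \<Longrightarrow> finite (pverts (lex_power G m))"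
  by (induction m) (simp_all add: map_graph_def lex_prod_graph_def)

lemma poly_independence_poly_lex_power:
  assumes "finite (pverts G)"
  shows "poly (independence_poly (lex_power G m)) z = (poly (independence_poly G - 1) ^^ m) z + 1"
proof (induction m)
  case 0
  \<comment> \<open>The one-vertex graph has polynomial \<open>1 + z\<close>, which matches the
    zeroth iterate, the identity.\<close>
  have "{S. independent_set (lex_power G 0) S} = {{}, {[]}}"
    by (auto simp: independent_set_def)
  then show ?case by (simp add: poly_independence_poly)
next
  case (Suc m)
  have "inj (\<lambda>(a::'a, x). a # x)" by (auto simp: inj_def)
  then show ?case
    using assms Suc finite_pverts_lex_power[OF assms, of m]
    by (simp add: poly_independence_poly_map_graph poly_independence_poly_lex_prod_graph
        lex_prod_graph_def[THEN arg_cong[where f=pverts]])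
qed

lemma coeff_independence_poly:
  assumes "finite (pverts G)"
  shows "coeff (independence_poly G) i = of_nat (num_independent_sets G i)"
proof (cases "i \<le> independence_number G")
  case True
  then show ?thesis by (simp add: independence_poly_def coeff_sum)
next
  case False
  have "finite {S. independent_set G S}"
    by (rule finite_subset[of _ "Pow (pverts G)"]) (use assms in \<open>auto simp: independent_set_def\<close>)
  then have "{S. independent_set G S \<and> card S = i} = {}"
    using False by (auto simp: independence_number_def)
  then show ?thesis
    using False
    by (simp add: independence_poly_def coeff_sum num_independent_sets_def del: Collect_empty_eq)
qed

lemma num_independent_sets_1:
  assumes "pair_graph G"
  shows "num_independent_sets G 1 = card (pverts G)"
proof -
  interpret pair_graph G by fact
  have "{S. independent_set G S \<and> card S = 1} = (\<lambda>x. {x}) ` pverts G"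
    by (auto simp: independent_set_def card_1_singleton_iff dest: no_loops)
  then show ?thesis
    by (simp add: num_independent_sets_def card_image)
qed

text \<open>The only vertex set of full size is \<open>pverts G\<close> itself. This recognises the
  exceptional edgeless graph on three vertices.\<close>

lemma edgeless_if_independent_set_card_pverts:
  assumes "pair_graph G" "num_independent_sets G (card (pverts G)) \<ge> 1"
  shows "parcs G = {}"
proof -
  interpret pair_graph G by fact
  have "{S. independent_set G S \<and> card S = card (pverts G)} \<noteq> {}"
    using assms(2) by (force simp: num_independent_sets_def)
  then obtain S where S: "independent_set G S" "card S = card (pverts G)" by auto
  then have "S = pverts G"
    by (intro card_subset_eq) (auto simp: independent_set_def)
  then show ?thesis
    using S arc_fst_in_verts arc_snd_in_verts by (fastforce simp: independent_set_def)
qed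

section \<open>The filled-in Julia set of a polynomial\<close>

lemma funpow_poly_conv:
  fixes p :: "'a::idom poly"
  shows "\<exists>q. poly p ^^ n = poly q \<and> degree q = degree p ^ n"
proof (induction n)
  case 0
  have "poly p ^^ 0 = poly [:0, 1:]" by auto
  then show ?case by (intro exI[of _ "[:0, 1:]"]) simp
next
  case (Suc n)
  then obtain q where "poly p ^^ n = poly q" "degree q = degree p ^ n" by blast
  then show ?case
    by (intro exI[of _ "pcompose p q"]) (auto simp: poly_pcompose degree_pcompose fun_eq_iff)
qed

lemma holomorphic_on_funpow_poly [holomorphic_intros]:
  "(poly p ^^ n) holomorphic_on S"
proof -
  obtain q where "poly p ^^ n = poly q" using funpow_poly_conv by blast
  then show ?thesis by (auto intro: holomorphic_intros)
qed

lemma continuous_on_funpow_poly [continuous_intros]: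
  fixes p :: "complex poly"
  shows "continuous_on S (poly p ^^ n)"
  by (intro holomorphic_on_imp_continuous_on holomorphic_on_funpow_poly)

lemma open_vimage_funpow_poly:
  fixes p :: "complex poly"
  shows "open S \<Longrightarrow> open ((poly p ^^ n) -` S)"
  by (intro open_vimage continuous_on_funpow_poly)

lemma funpow_poly_surj:
  fixes p :: "complex poly"
  assumes "degree p \<ge> 1"
  shows "\<exists>x. (poly p ^^ n) x = w"
proof -
  obtain q where q: "poly p ^^ n = poly q" "degree q = degree p ^ n"
    using funpow_poly_conv by blast
  have "degree (q - [:w:]) = degree q"
    using assms q degree_add_eq_left[of "- [:w:]" q] by (simp del: minus_pCons)
  then have "\<exists>x. poly (q - [:w:]) x = 0"
    using assms q by (intro alg_closed_imp_poly_has_root) auto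
  then show ?thesis using q by auto
qed

text \<open>An orbit that reaches modulus \<open>R\<close> tends to infinity, so the single bound
  \<open>R\<close> decides whether an orbit is bounded.\<close>

definition escape_radius :: "complex poly \<Rightarrow> real \<Rightarrow> bool" where
  "escape_radius p R \<longleftrightarrow> R \<ge> 2 \<and> (\<forall>z. R \<le> cmod z \<longrightarrow> 2 * cmod z \<le> cmod (poly p z))"

lemma escape_radius_exists:
  assumes "degree p \<ge> 2"
  shows "\<exists>R. escape_radius p R"
proof -
  obtain a q where p: "p = pCons a q" by (cases p)
  then have "degree q \<ge> 1" using assms by (auto split: if_splits)
  then obtain b q' where q: "q = pCons b q'" "q' \<noteq> 0"
    by (cases q) (auto split: if_splits)
  \<comment> \<open>With p(z) = a + z q(z), the factor 3 pays for the constant \<open>a\<close>,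
    whose modulus is at most that of \<open>z\<close>, and still leaves doubling.\<close>
  obtain r where r: "\<And>z. r \<le> cmod z \<Longrightarrow> 3 \<le> cmod (poly q z)"
    using poly_infinity[of q' 3 b] q by auto
  have "2 * cmod z \<le> cmod (poly p z)" if "max 2 (max r (cmod a)) \<le> cmod z" for z
  proof -
    have "3 * cmod z \<le> cmod (poly q z) * cmod z"
      using that r by (intro mult_right_mono) auto
    also have "\<dots> = cmod (poly p z - a)" by (simp add: p norm_mult mult.commute)
    also have "\<dots> \<le> cmod (poly p z) + cmod a" by (rule norm_triangle_ineq4)
    finally show ?thesis using that by simp
  qed
  then show ?thesis
    by (intro exI[of _ "max 2 (max r (cmod a))"]) (auto simp: escape_radius_def)
qed

lemma escape_radius_funpow:
  assumes "escape_radius p R" "R \<le> cmod z"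
  shows "2 ^ n * cmod z \<le> cmod ((poly p ^^ n) z)"
proof (induction n)
  case (Suc n)
  have "R \<le> cmod z * 1" using assms by simp
  also have "\<dots> \<le> cmod z * 2 ^ n" by (intro mult_left_mono) auto
  also have "\<dots> \<le> cmod ((poly p ^^ n) z)" using Suc by (simp add: mult.commute)
  finally have "2 * cmod ((poly p ^^ n) z) \<le> cmod (poly p ((poly p ^^ n) z))"
    using assms by (simp add: escape_radius_def)
  then show ?case using Suc by simp
qed simp

text \<open>Exceeding \<open>R\<close> at time \<open>n0\<close> is an open condition, and doubling
  from then on beats any bound \<open>M\<close> at a time common to the whole neighbourhood.\<close>

lemma escape_uniform:
  assumes R: "escape_radius p R" and z: "R < cmod ((poly p ^^ n0) z)"
  shows "\<exists>N n1. open N \<and> z \<in> N \<and> (\<forall>y\<in>N. \<forall>n\<ge>n1. M < cmod ((poly p ^^ n) y))"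
proof -
  let ?N = "(poly p ^^ n0) -` (- cball 0 R)"
  obtain k :: nat where k: "max M 1 < 2 ^ k" using real_arch_pow[of 2 "max M 1"] by auto
  have "M < cmod ((poly p ^^ n) y)" if y: "y \<in> ?N" and n: "n \<ge> n0 + k" for y n
  proof -
    define j where "j = n - n0"
    have j: "n = j + n0" "k \<le> j" using n by (auto simp: j_def)
    have R1: "1 \<le> R" using R by (simp add: escape_radius_def)
    have y': "R < cmod ((poly p ^^ n0) y)" using y by auto
    have "M < 2 ^ k * 1" using k by simp
    also have "\<dots> \<le> 2 ^ j * cmod ((poly p ^^ n0) y)"
      using j y' R1 by (intro mult_mono power_increasing) auto
    also have "\<dots> \<le> cmod ((poly p ^^ j) ((poly p ^^ n0) y))"
      using R y' by (intro escape_radius_funpow) auto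
    finally show ?thesis by (simp add: j funpow_add)
  qed
  moreover have "open ?N" by (intro open_vimage_funpow_poly) auto
  moreover have "z \<in> ?N" using z by simp
  ultimately show ?thesis by blast
qed

lemma filled_julia_set_eq:
  assumes R: "escape_radius p R"
  shows "filled_julia_set p = {z. \<forall>n. cmod ((poly p ^^ n) z) \<le> R}"
proof (intro set_eqI iffI CollectI allI)
  fix z n assume z: "z \<in> filled_julia_set p"
  then obtain M where M: "\<And>n. n > 0 \<Longrightarrow> cmod ((poly p ^^ n) z) \<le> M"
    by (auto simp: filled_julia_set_def bounded_iff)
  show "cmod ((poly p ^^ n) z) \<le> R"
  proof (rule ccontr)
    assume "\<not> ?thesis"
    then obtain N n1 where "z \<in> N" "\<forall>y\<in>N. \<forall>n\<ge>n1. M < cmod ((poly p ^^ n) y)"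
      using escape_uniform[OF R, of n z M] by auto
    \<comment> \<open>\<open>Suc n1\<close> is positive, and the definition of
      \<open>filled_julia_set\<close> bounds positive iterates only.\<close>
    then have "M < cmod ((poly p ^^ Suc n1) z)" using le_SucI by blast
    then show False using M[of "Suc n1"] by simp
  qed
next
  fix z assume "z \<in> {z. \<forall>n. cmod ((poly p ^^ n) z) \<le> R}"
  then show "z \<in> filled_julia_set p"
    by (auto simp: filled_julia_set_def bounded_iff)
qed

text \<open>Boundedness of an orbit depends only on its tail.\<close>

lemma funpow_in_filled_julia_set_iff:
  assumes "degree p \<ge> 2"
  shows "(poly p ^^ n) z \<in> filled_julia_set p \<longleftrightarrow> z \<in> filled_julia_set p"
proof -
  obtain R where R: "escape_radius p R" using escape_radius_exists assms by blast
  have "z \<in> filled_julia_set p" if *: "(poly p ^^ n) z \<in> filled_julia_set p"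
  proof (rule ccontr)
    assume "z \<notin> filled_julia_set p"
    then obtain m where "R < cmod ((poly p ^^ m) z)" by (auto simp: filled_julia_set_eq[OF R] not_le)
    then obtain N n1 where "z \<in> N" "\<forall>y\<in>N. \<forall>n\<ge>n1. R < cmod ((poly p ^^ n) y)"
      using escape_uniform[OF R, of m z R] by auto
    then have "R < cmod ((poly p ^^ (n1 + n)) z)" by simp
    then show False using * by (auto simp: filled_julia_set_eq[OF R] funpow_add not_le[symmetric])
  qed
  moreover have "(poly p ^^ n) z \<in> filled_julia_set p" if "z \<in> filled_julia_set p"
  proof -
    have "cmod ((poly p ^^ (m + n)) z) \<le> R" for m
      using that by (simp add: filled_julia_set_eq[OF R])
    then show ?thesis by (simp add: filled_julia_set_eq[OF R] funpow_add)
  qed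
  ultimately show ?thesis by blast
qed

section \<open>Topology of the filled-in Julia set\<close>

lemma compact_filled_julia_set:
  assumes "degree p \<ge> 2" shows "compact (filled_julia_set p)"
proof -
  obtain R where R: "escape_radius p R" using escape_radius_exists assms by blast
  have "filled_julia_set p = (\<Inter>n. (poly p ^^ n) -` cball 0 R)"
    by (auto simp: filled_julia_set_eq[OF R])
  moreover have "closed \<dots>"
    by (intro closed_INT ballI closed_vimage continuous_on_funpow_poly closed_cball)
  moreover have "filled_julia_set p \<subseteq> cball 0 R"
    by (auto simp: filled_julia_set_eq[OF R] dest: spec[of _ 0])
  ultimately show ?thesis
    by (metis bounded_cball bounded_subset compact_eq_bounded_closed)
qed

lemma filled_julia_set_nonempty:
  assumes "degree p \<ge> 2" shows "filled_julia_set p \<noteq> {}"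
proof -
  have "degree (p - [:0, 1:]) = degree p"
    using assms degree_add_eq_left[of "- [:0, 1:]" p] by (simp del: minus_pCons)
  then obtain x where "poly (p - [:0, 1:]) x = 0"
    using alg_closed_imp_poly_has_root[of "p - [:0, 1:]"] assms by auto
  then have "(poly p ^^ n) x = x" for n by (induction n) auto
  then have "x \<in> filled_julia_set p" by (auto simp: filled_julia_set_def bounded_iff)
  then show ?thesis by auto
qed

lemma compact_julia_set: "degree p \<ge> 2 \<Longrightarrow> compact (julia_set p)"
  unfolding julia_set_def by (intro compact_frontier compact_filled_julia_set)

lemma julia_set_nonempty:
  assumes "degree p \<ge> 2" shows "julia_set p \<noteq> {}"
  unfolding julia_set_def
proof (rule frontier_not_empty)
  show "filled_julia_set p \<noteq> UNIV"
    using compact_filled_julia_set[OF assms] not_bounded_UNIV compact_imp_bounded by metis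
qed (rule filled_julia_set_nonempty[OF assms])

lemma filled_julia_set_eq_Un:
  assumes "degree p \<ge> 2"
  shows "filled_julia_set p = julia_set p \<union> interior (filled_julia_set p)"
    "julia_set p \<inter> interior (filled_julia_set p) = {}"
  using compact_imp_closed[OF compact_filled_julia_set[OF assms]] interior_subset[of "filled_julia_set p"]
  by (auto simp: julia_set_def frontier_def closure_closed)

text \<open>Backwards this is continuity, forwards the open mapping theorem, each combined with the
  invariance of \<open>filled_julia_set p\<close>.\<close>

lemma funpow_in_interior_filled_julia_set_iff:
  assumes "degree p \<ge> 2"
  shows "(poly p ^^ n) z \<in> interior (filled_julia_set p) \<longleftrightarrow> z \<in> interior (filled_julia_set p)"
proof
  let ?K = "filled_julia_set p"
  assume "(poly p ^^ n) z \<in> interior ?K"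
  moreover have "open ((poly p ^^ n) -` interior ?K)" by (intro open_vimage_funpow_poly) auto
  moreover have "(poly p ^^ n) -` interior ?K \<subseteq> ?K"
    using funpow_in_filled_julia_set_iff[OF assms] interior_subset by blast
  ultimately show "z \<in> interior ?K" by (meson interiorI vimageI)
next
  let ?K = "filled_julia_set p"
  assume z: "z \<in> interior ?K"
  obtain x y where xy: "(poly p ^^ n) x = 0" "(poly p ^^ n) y = 1"
    using funpow_poly_surj[of p n] assms by (metis One_nat_def Suc_1 Suc_leD)
  have "\<not> (poly p ^^ n) constant_on UNIV"
    using xy by (metis UNIV_I constant_on_def zero_neq_one)
  then have "open ((poly p ^^ n) ` interior ?K)"
    by (intro open_mapping_thm[of _ UNIV] holomorphic_on_funpow_poly) auto
  moreover have "(poly p ^^ n) ` interior ?K \<subseteq> ?K"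
    using funpow_in_filled_julia_set_iff[OF assms] interior_subset by blast
  ultimately show "(poly p ^^ n) z \<in> interior ?K" using z by (meson imageI interiorI)
qed

text \<open>The iterates are uniformly bounded on the filled-in Julia set, so Cauchy's estimate applies.\<close>

lemma funpow_equi_lipschitz:
  assumes "degree p \<ge> 2" "z \<in> interior (filled_julia_set p)"
  shows "\<exists>d>0. \<exists>L>0. \<forall>x\<in>ball z d. \<forall>y\<in>ball z d. \<forall>n.
           cmod ((poly p ^^ n) x - (poly p ^^ n) y) \<le> L * cmod (x - y)"
proof -
  obtain R where R: "escape_radius p R" using escape_radius_exists assms by blast
  obtain e where e: "e > 0" "cball z e \<subseteq> filled_julia_set p"
    using assms(2) mem_interior_cball by blast
  \<comment> \<open>Halving keeps closed discs of radius \<open>d\<close> about points of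
    \<open>ball z d\<close> inside the filled-in Julia set.\<close>
  define d where "d = e / 2"
  have d: "d > 0" using e by (simp add: d_def)
  have R0: "R > 0" using R by (simp add: escape_radius_def)
  have "cmod ((poly p ^^ n) x - (poly p ^^ n) y) \<le> R / d * cmod (x - y)"
    if xy: "x \<in> ball z d" "y \<in> ball z d" for x y n
  proof (rule field_differentiable_bound[where f = "poly p ^^ n" and f' = "deriv (poly p ^^ n)" and S = "ball z d"])
    fix w assume w: "w \<in> ball z d"
    show "((poly p ^^ n) has_field_derivative deriv (poly p ^^ n) w) (at w within ball z d)"
      by (rule has_field_derivative_at_within, rule holomorphic_derivI[of _ UNIV])
        (auto intro: holomorphic_on_funpow_poly)
    have "cball w d \<subseteq> filled_julia_set p"
    proof
      fix u assume "u \<in> cball w d"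
      then have "dist z u \<le> e"
        using w dist_triangle[of z u w] by (auto simp: d_def)
      then show "u \<in> filled_julia_set p" using e by auto
    qed
    then have "cmod ((poly p ^^ n) u) \<le> R" if "cmod (w - u) = d" for u
      using that filled_julia_set_eq[OF R] by (auto simp: subset_iff dist_norm)
    then have "cmod ((deriv ^^ 1) (poly p ^^ n) w) \<le> fact 1 * R / d ^ 1"
      by (intro Cauchy_inequality holomorphic_on_funpow_poly continuous_on_funpow_poly d)
    then show "cmod (deriv (poly p ^^ n) w) \<le> R / d" by simp
  qed (use xy in auto)
  then show ?thesis using d R0 by (intro exI[of _ d] conjI exI[of _ "R / d"]) auto
qed

section \<open>Multipliers and backward orbits\<close>

text \<open>
  Cartan's uniqueness argument: if the multiplier at \<open>c\<close> is 1, write \<open>q(z) - z = (z - c)\<^sup>k g(z)\<close> with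
  \<open>g(c) \<noteq> 0\<close>. Then \<open>q\<^sup>n(z) - z\<close> is \<open>(z - c)\<^sup>k\<close> times a function with value \<open>n g(c)\<close> at \<open>c\<close>, which
  contradicts Cauchy's estimate for large \<open>n\<close>.
\<close>

lemma multiplier_if_iterates_bounded:
  fixes q :: "complex poly"
  assumes qc: "poly q c = c" and deg: "degree q \<ge> 2" and r: "r > 0"
    and bnd: "\<And>n z. cmod (c - z) = r \<Longrightarrow> cmod ((poly q ^^ n) z) \<le> B"
  shows "cmod (poly (pderiv q) c) \<le> 1" "poly (pderiv q) c \<noteq> 1"
proof -
  have "[:- c, 1:] dvd q - [:c:]" using qc by (simp add: poly_eq_0_iff_dvd[symmetric])
  then obtain v where v: "q - [:c:] = [:- c, 1:] * v" by (elim dvdE)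
  have qv: "poly q z - c = (z - c) * poly v z" for z
    using arg_cong[OF v, of "\<lambda>f. poly f z"] by (simp add: algebra_simps)
  have "pderiv q = pderiv (q - [:c:])" by (simp add: pderiv_diff pderiv_pCons)
  then have vc: "poly (pderiv q) c = poly v c"
    unfolding v pderiv_mult by (simp add: pderiv_pCons)
  have fixn: "(poly q ^^ n) c = c" for n by (induction n) (auto simp: qc)
  \<comment> \<open>\<open>u n\<close> is the difference quotient of the \<open>n\<close>-th iterate
    at \<open>c\<close>, written as a product along the orbit; its value at \<open>c\<close> is the
    \<open>n\<close>-th power of the multiplier.\<close>
  define u where "u n z = (\<Prod>i<n. poly v ((poly q ^^ i) z))" for n z
  have u: "(poly q ^^ n) z - c = (z - c) * u n z" for n z
    by (induction n) (auto simp: u_def qv)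
  have uc: "u n c = poly v c ^ n" for n by (simp add: u_def fixn)
  have hol: "(\<lambda>z. poly g ((poly q ^^ i) z)) holomorphic_on S" for g i S
    using holomorphic_on_compose[OF holomorphic_on_funpow_poly[where p = q and n = i and S = S], of "poly g"]
    by (auto simp: o_def intro: holomorphic_intros)
  have holu: "u n holomorphic_on S" for n S
    unfolding u_def[abs_def] by (intro holomorphic_on_prod hol)
  have est: "cmod (f c) \<le> M" if "f holomorphic_on UNIV" "\<And>z. cmod (c - z) = r \<Longrightarrow> cmod (f z) \<le> M" for f M
  proof -
    have "f holomorphic_on ball c r" "f holomorphic_on cball c r"
      using that(1) by (auto intro: holomorphic_on_subset)
    then show ?thesis
      using Cauchy_inequality[of f c r M 0] r that(2) holomorphic_on_imp_continuous_on by auto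
  qed
  have pow: "cmod (poly v c) ^ n \<le> (B + cmod c) / r" for n
  proof -
    have "cmod (u n z) \<le> (B + cmod c) / r" if z: "cmod (c - z) = r" for z
    proof -
      have "cmod (u n z) * r = cmod ((poly q ^^ n) z - c)"
        using z by (simp add: u norm_mult norm_minus_commute)
      also have "\<dots> \<le> cmod ((poly q ^^ n) z) + cmod c" by (rule norm_triangle_ineq4)
      also have "\<dots> \<le> B + cmod c" using bnd z by simp
      finally show ?thesis using r by (simp add: field_simps)
    qed
    then have "cmod (u n c) \<le> (B + cmod c) / r" by (rule est[OF holu])
    then show ?thesis by (simp add: uc norm_power)
  qed
  show "cmod (poly (pderiv q) c) \<le> 1"
  proof (rule ccontr)
    assume "\<not> ?thesis"
    then obtain n where "(B + cmod c) / r < cmod (poly v c) ^ n"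
      using real_arch_pow vc by (metis not_le)
    then show False using pow[of n] by simp
  qed
  show "poly (pderiv q) c \<noteq> 1"
  proof
    assume "poly (pderiv q) c = 1"
    then have v1: "poly v c = 1" using vc by simp
    define h where "h = q - [:0, 1:]"
    have "degree h = degree q"
      unfolding h_def using deg degree_add_eq_left[of "- [:0, 1:]" q] by (simp del: minus_pCons)
    then have "h \<noteq> 0" using deg by auto
    define k where "k = order c h"
    obtain g where g: "h = [:- c, 1:] ^ k * g" "\<not> [:- c, 1:] dvd g"
      using order_decomp[OF \<open>h \<noteq> 0\<close>, of c] by (auto simp: k_def)
    have gc: "poly g c \<noteq> 0" using g by (simp add: poly_eq_0_iff_dvd)
    have qg: "poly q z - z = (z - c) ^ k * poly g z" for z
      using arg_cong[OF g(1), of "\<lambda>f. poly f z"] by (simp add: h_def algebra_simps)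
    \<comment> \<open>\<open>W n\<close> comes from telescoping the \<open>n\<close>-th iterate
      minus \<open>z\<close> along the orbit and pulling a factor \<open>(z - c) ^ k\<close> out of
      each step; at \<open>c\<close> each of its \<open>n\<close> terms is
      \<open>poly g c\<close>.\<close>
    define W where "W n z = (\<Sum>i<n. u i z ^ k * poly g ((poly q ^^ i) z))" for n z
    have W: "(poly q ^^ n) z - z = (z - c) ^ k * W n z" for n z
    proof (induction n)
      case 0
      then show ?case by (simp add: W_def)
    next
      case (Suc n)
      have "(poly q ^^ Suc n) z - z = (poly q ((poly q ^^ n) z) - (poly q ^^ n) z) + ((poly q ^^ n) z - z)"
        by simp
      also have "\<dots> = ((poly q ^^ n) z - c) ^ k * poly g ((poly q ^^ n) z) + (z - c) ^ k * W n z"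
        by (simp only: qg Suc)
      also have "\<dots> = (z - c) ^ k * W (Suc n) z"
        by (simp add: u power_mult_distrib W_def distrib_left mult.assoc add.commute)
      finally show ?case .
    qed
    have "real n * cmod (poly g c) \<le> (B + (cmod c + r)) / r ^ k" for n
    proof -
      have "cmod (W n z) \<le> (B + (cmod c + r)) / r ^ k" if z: "cmod (c - z) = r" for z
      proof -
        have "cmod z \<le> cmod c + cmod (c - z)"
          by (metis norm_minus_commute norm_triangle_sub)
        moreover have "cmod (W n z) * r ^ k = cmod ((poly q ^^ n) z - z)"
          using z by (simp add: W norm_mult norm_power norm_minus_commute)
        moreover have "\<dots> \<le> cmod ((poly q ^^ n) z) + cmod z" by (rule norm_triangle_ineq4)
        moreover have "cmod ((poly q ^^ n) z) \<le> B" using bnd z by simp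
        ultimately show ?thesis using r z by (simp add: field_simps)
      qed
      moreover have "W n holomorphic_on UNIV"
        unfolding W_def[abs_def] by (intro holomorphic_on_sum holomorphic_on_mult holomorphic_on_power holu hol)
      ultimately have "cmod (W n c) \<le> (B + (cmod c + r)) / r ^ k" using est by blast
      then show ?thesis by (simp add: W_def uc v1 fixn norm_mult)
    qed
    moreover obtain n where "(B + (cmod c + r)) / r ^ k < real n * cmod (poly g c)"
      using reals_Archimedean3[of "cmod (poly g c)"] gc by auto
    ultimately show False by (metis not_le)
  qed
qed

text \<open>The cycle becomes a fixed point of the polynomial \<open>q\<close> that represents the
  \<open>n\<close>-th iterate. Iterates of \<open>q\<close> are iterates of \<open>p\<close>, hence
  bounded by \<open>R\<close> on a circle about \<open>c\<close>.\<close>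

lemma multiplier_in_interior_filled_julia_set:
  assumes deg: "degree p \<ge> 2" and c: "c \<in> interior (filled_julia_set p)"
    and n: "n \<ge> 1" "(poly p ^^ n) c = c" and d: "((poly p ^^ n) has_field_derivative d) (at c)"
  shows "cmod d \<le> 1" "d \<noteq> 1"
proof -
  obtain q where q: "poly p ^^ n = poly q" "degree q = degree p ^ n"
    using funpow_poly_conv by blast
  have "2 ^ 1 \<le> degree p ^ n"
    using deg n by (intro order_trans[OF power_increasing[of 1 n 2] power_mono]) auto
  then have dq: "degree q \<ge> 2" using q by simp
  have dd: "d = poly (pderiv q) c"
    using d DERIV_unique poly_DERIV unfolding q by blast
  obtain R where R: "escape_radius p R" using escape_radius_exists deg by blast
  obtain r where r: "r > 0" "cball c r \<subseteq> filled_julia_set p"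
    using c mem_interior_cball by blast
  have "cmod ((poly q ^^ m) z) \<le> R" if "cmod (c - z) = r" for m z
  proof -
    have "z \<in> filled_julia_set p" using r that by (auto simp: subset_iff dist_norm)
    moreover have "poly q ^^ m = poly p ^^ (n * m)" by (simp add: q(1)[symmetric] funpow_mult)
    ultimately show ?thesis by (simp add: filled_julia_set_eq[OF R])
  qed
  then show "cmod d \<le> 1" "d \<noteq> 1"
    using multiplier_if_iterates_bounded[of q c r R] n dq r(1) unfolding dd q(1) by blast+
qed

section \<open>Cycles of integers\<close>

lemma poly_in_Ints:
  fixes p :: "'a::comm_ring_1 poly"
  assumes "\<And>i. coeff p i \<in> \<int>" "x \<in> \<int>"
  shows "poly p x \<in> \<int>"
  unfolding poly_altdef using assms by (intro Ints_sum Ints_mult Ints_power)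

lemma funpow_poly_int_derivative:
  fixes p :: "complex poly"
  assumes int: "\<And>i. coeff p i \<in> \<int>" and x: "x \<in> \<int>"
  shows "(poly p ^^ n) x \<in> \<int> \<and> (\<exists>d\<in>\<int>. ((poly p ^^ n) has_field_derivative d) (at x))"
proof (induction n)
  case 0
  have "((poly p ^^ 0) has_field_derivative 1) (at x)" by (simp add: id_def)
  then show ?case using x by (metis Ints_1 funpow_0)
next
  case (Suc n)
  then obtain d where d: "d \<in> \<int>" "((poly p ^^ n) has_field_derivative d) (at x)"
    and y: "(poly p ^^ n) x \<in> \<int>" by auto
  have "coeff (pderiv p) i \<in> \<int>" for i
    unfolding coeff_pderiv by (intro Ints_mult int) auto
  then have "poly (pderiv p) ((poly p ^^ n) x) \<in> \<int>" using y by (rule poly_in_Ints)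
  moreover have "((poly p ^^ Suc n) has_field_derivative poly (pderiv p) ((poly p ^^ n) x) * d) (at x)"
    using DERIV_chain[OF poly_DERIV d(2)] by simp
  moreover have "(poly p ^^ Suc n) x \<in> \<int>" using poly_in_Ints[OF int y] by simp
  ultimately show ?case using d(1) Ints_mult by blast
qed

text \<open>An integer of modulus at most 1 other than 1 is 0 or -1. Going round the cycle twice has
  multiplier \<open>d * d\<close>, which is not 1 either, so -1 is excluded.\<close>

lemma int_multiplier_zero:
  assumes deg: "degree p \<ge> 2" and int: "\<And>i. coeff p i \<in> \<int>"
    and c: "c \<in> interior (filled_julia_set p)" "c \<in> \<int>"
    and n: "n \<ge> 1" "(poly p ^^ n) c = c"
  shows "((poly p ^^ n) has_field_derivative 0) (at c)"
proof -
  obtain d where d: "d \<in> \<int>" "((poly p ^^ n) has_field_derivative d) (at c)"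
    using funpow_poly_int_derivative[OF int c(2)] by blast
  have "((poly p ^^ n \<circ> poly p ^^ n) has_field_derivative d * d) (at c)"
    using d(2) n by (intro DERIV_chain) simp_all
  then have d2: "((poly p ^^ (n + n)) has_field_derivative d * d) (at c)"
    by (simp add: funpow_add)
  have "d * d \<noteq> 1"
    using n by (intro multiplier_in_interior_filled_julia_set(2)[OF deg c(1) _ _ d2]) (auto simp: funpow_add)
  moreover have "cmod d \<le> 1" "d \<noteq> 1"
    using multiplier_in_interior_filled_julia_set[OF deg c(1) n d(2)] by auto
  moreover obtain k :: int where k: "d = of_int k" using d(1) by (elim Ints_cases)
  ultimately have "\<bar>k\<bar> \<le> 1" "k \<noteq> 1" "k \<noteq> - 1"
    by auto
  then have "d = 0" using k by simp
  then show ?thesis using d(2) by simp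
qed

section \<open>Accumulation of preimages\<close>

text \<open>If a ball about \<open>z\<close> misses the preimages at time \<open>k + n\<close>, the
  \<open>n\<close>-th iterate omits \<open>u\<close> and \<open>v\<close> there, and Schottky's
  theorem bounds it on a smaller ball independently of \<open>n\<close>. For infinitely many
  \<open>n\<close> this contradicts the escaping points near \<open>z\<close>.\<close>

lemma preimages_approach_julia_set:
  assumes deg: "degree p \<ge> 2"
    and uv: "u \<noteq> v" "(poly p ^^ k) u = w" "(poly p ^^ k) v = w"
    and z: "z \<in> julia_set p" and e: "e > 0"
  shows "\<forall>\<^sub>F m in sequentially. {x. (poly p ^^ m) x = w} \<inter> ball z e \<noteq> {}"
proof (rule ccontr)
  assume "\<not> ?thesis"
  then have freq: "\<exists>\<^sub>F m in sequentially. {x. (poly p ^^ m) x = w} \<inter> ball z e = {}"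
    by (simp add: frequently_def)
  obtain R where R: "escape_radius p R" using escape_radius_exists deg by blast
  have zK: "z \<in> filled_julia_set p" using z filled_julia_set_eq_Un[OF deg] by blast
  \<comment> \<open>\<open>r\<close> bounds the normalised iterate at the centre; \<open>M\<close>
    is Schottky's bound at radius 1/2 with the normalisation undone.\<close>
  define r where "r = (R + cmod u) / cmod (v - u)"
  define M where "M = cmod (v - u) * exp (pi * exp (pi * (2 + 2 * r + 12 * (1/2) / (1 - 1/2)))) + cmod u"
  have bound: "cmod ((poly p ^^ n) x) \<le> M"
    if m: "{x. (poly p ^^ (k + n)) x = w} \<inter> ball z e = {}" and x: "x \<in> ball z (e / 4)" for n x
  proof -
    \<comment> \<open>Affine changes carry \<open>u\<close> and \<open>v\<close> to 0 and 1, and the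
      disc of radius \<open>e / 2\<close> about \<open>z\<close> to the unit disc; radius
      \<open>e / 4\<close> becomes 1/2.\<close>
    define g where "g t = ((poly p ^^ n) (z + of_real (e / 2) * t) - u) / (v - u)" for t
    define t where "t = (x - z) / of_real (e / 2)"
    have "cmod (g t) \<le> exp (pi * exp (pi * (2 + 2 * r + 12 * (1/2) / (1 - 1/2))))"
    proof (rule Schottky[where f = g and r = r and t = "1/2" and z = t])
      have "(poly p ^^ n \<circ> (\<lambda>t. z + of_real (e / 2) * t)) holomorphic_on cball 0 1"
        by (rule holomorphic_on_compose) (intro holomorphic_intros)+
      then have "(\<lambda>t. (poly p ^^ n) (z + of_real (e / 2) * t)) holomorphic_on cball 0 1"
        by (simp add: o_def)
      then show "g holomorphic_on cball 0 1"
        unfolding g_def[abs_def] using uv(1) by (intro holomorphic_intros) auto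
      have "cmod ((poly p ^^ n) z - u) \<le> R + cmod u"
        using zK norm_triangle_ineq4[of "(poly p ^^ n) z" u]
        by (simp add: filled_julia_set_eq[OF R]) (smt (verit))
      then show "cmod (g 0) \<le> r"
        by (simp add: g_def r_def norm_divide divide_right_mono)
      show "\<not> (g s = 0 \<or> g s = 1)" if "s \<in> cball 0 1" for s
      proof
        let ?y = "z + of_real (e / 2) * s"
        have "dist z ?y = e / 2 * cmod s" using e by (simp add: dist_norm norm_mult)
        also have "\<dots> \<le> e / 2 * 1" using that e by (intro mult_left_mono) auto
        finally have "?y \<in> ball z e" using e by simp
        then have "(poly p ^^ k) ((poly p ^^ n) ?y) \<noteq> w" using m by (auto simp: funpow_add)
        moreover assume "g s = 0 \<or> g s = 1"
        then have "(poly p ^^ n) ?y = u \<or> (poly p ^^ n) ?y = v"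
          using uv(1) by (auto simp: g_def)
        ultimately show False using uv by auto
      qed
      have "cmod (x - z) \<le> e / 4" using x by (simp add: dist_norm norm_minus_commute)
      then show "cmod t \<le> 1/2"
        using e unfolding t_def norm_divide norm_of_real by (simp add: field_simps)
    qed auto
    moreover have "z + of_real (e / 2) * t = x"
      using e unfolding t_def by (metis add.commute diff_add_cancel half_gt_zero less_irrefl
          nonzero_mult_div_cancel_left of_real_eq_0_iff times_divide_eq_right)
    then have "(poly p ^^ n) x = (v - u) * g t + u"
      using uv(1) by (simp add: g_def)
    then have "cmod ((poly p ^^ n) x) \<le> cmod (v - u) * cmod (g t) + cmod u"
      by (metis norm_mult norm_triangle_ineq)
    ultimately show ?thesis
      unfolding M_def by (smt (verit) mult_left_mono norm_ge_zero)
  qed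
  have "z \<in> frontier (filled_julia_set p)" "0 < e / 4" using z e by (auto simp: julia_set_def)
  then have "\<exists>x. x \<notin> filled_julia_set p \<and> dist z x < e / 4"
    unfolding frontier_straddle by blast
  then obtain x where x: "x \<notin> filled_julia_set p" "x \<in> ball z (e / 4)"
    unfolding mem_ball by blast
  then obtain n0 where "R < cmod ((poly p ^^ n0) x)"
    by (auto simp: filled_julia_set_eq[OF R] not_le)
  then obtain N n1 where n1: "x \<in> N" "\<forall>y\<in>N. \<forall>n\<ge>n1. M < cmod ((poly p ^^ n) y)"
    using escape_uniform[OF R, of n0 x M] by auto
  obtain m where "m \<ge> k + n1" "{x. (poly p ^^ m) x = w} \<inter> ball z e = {}"
    using freq unfolding frequently_sequentially by blast
  then have "cmod ((poly p ^^ (m - k)) x) \<le> M" "m - k \<ge> n1"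
    using bound[of "m - k" x] x by auto
  then show False using n1 by fastforce
qed

text \<open>Escape settles the points outside the filled-in Julia set and
  \<open>preimages_approach_julia_set\<close> those on its boundary, so only the interior is left to
  the hypotheses.\<close>

lemma hausdorff_limit_preimages:
  assumes deg: "degree p \<ge> 2"
    and uv: "u \<noteq> v" "(poly p ^^ k) u = w" "(poly p ^^ k) v = w"
    and A: "closed A" "julia_set p \<subseteq> A" "A \<subseteq> filled_julia_set p"
    and away: "\<And>z. z \<in> interior (filled_julia_set p) \<Longrightarrow> z \<notin> A \<Longrightarrow>
      \<exists>N. open N \<and> z \<in> N \<and> (\<forall>\<^sub>F m in sequentially. {x. (poly p ^^ m) x = w} \<inter> N = {})"
    and near: "\<And>z. z \<in> interior (filled_julia_set p) \<Longrightarrow> z \<in> A \<Longrightarrow>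
      \<forall>\<^sub>F m in sequentially. (poly p ^^ m) z = w"
  shows "hausdorff_limit (\<lambda>m. {x. (poly p ^^ m) x = w}) A"
proof -
  let ?K = "filled_julia_set p"
  obtain R where R: "escape_radius p R" using escape_radius_exists deg by blast
  have R0: "R \<ge> 0" using R by (simp add: escape_radius_def)
  show ?thesis
  \<comment> \<open>An orbit that starts outside this ball never falls below its initial modulus,
    which exceeds \<open>cmod w\<close>.\<close>
  proof (rule hausdorff_limitI[where B = "cball 0 (R + cmod w)"])
    show "{x. (poly p ^^ m) x = w} \<subseteq> cball 0 (R + cmod w)" for m
    proof
      fix x assume x: "x \<in> {x. (poly p ^^ m) x = w}"
      show "x \<in> cball 0 (R + cmod w)"
      proof (rule ccontr)
        assume "\<not> ?thesis"
        then have less: "R + cmod w < cmod x" by simp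
        then have "R \<le> cmod x" by (smt (verit) norm_ge_zero)
        then have "2 ^ m * cmod x \<le> cmod w" using escape_radius_funpow[OF R, of x m] x by simp
        moreover have "1 * cmod x \<le> 2 ^ m * cmod x" by (intro mult_right_mono) auto
        ultimately show False using less R0 by simp
      qed
    qed
    have "closed ((poly p ^^ m) -` {w})" for m
      by (intro closed_vimage continuous_on_funpow_poly) auto
    then show "closed {x. (poly p ^^ m) x = w}" for m by (simp add: vimage_def)
    show "{x. (poly p ^^ m) x = w} \<noteq> {}" for m
      using funpow_poly_surj[of p m w] deg by auto
    have "?K \<subseteq> cball 0 R" by (auto simp: filled_julia_set_eq[OF R] dest: spec[of _ 0])
    then have "?K \<subseteq> cball 0 (R + cmod w)"
      by (rule order_trans) (simp add: subset_cball)
    then show "A \<subseteq> cball 0 (R + cmod w)" using A(3) by (rule order_trans[rotated])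
    show "A \<noteq> {}" using julia_set_nonempty[OF deg] A(2) by blast
    show "\<exists>N. open N \<and> z \<in> N \<and> (\<forall>\<^sub>F m in sequentially. {x. (poly p ^^ m) x = w} \<inter> N = {})"
      if z: "z \<notin> A" for z
    proof (cases "z \<in> ?K")
      case True
      then have "z \<in> interior ?K" using z A(2) filled_julia_set_eq_Un(1)[OF deg] by blast
      then show ?thesis using away z by blast
    next
      case False
      then obtain n0 where "R < cmod ((poly p ^^ n0) z)"
        by (auto simp: filled_julia_set_eq[OF R] not_le)
      then obtain N n1 where N: "open N" "z \<in> N" "\<forall>y\<in>N. \<forall>n\<ge>n1. cmod w < cmod ((poly p ^^ n) y)"
        using escape_uniform[OF R, of n0 z "cmod w"] by auto
      have "\<forall>\<^sub>F m in sequentially. {x. (poly p ^^ m) x = w} \<inter> N = {}"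
        using eventually_ge_at_top[of n1] by eventually_elim (use N in fastforce)
      then show ?thesis using N by blast
    qed
    show "\<forall>\<^sub>F m in sequentially. {x. (poly p ^^ m) x = w} \<inter> ball z e \<noteq> {}"
      if z: "z \<in> A" and e: "e > 0" for z e
    proof (cases "z \<in> julia_set p")
      case True
      then show ?thesis using preimages_approach_julia_set[OF deg uv] e by blast
    next
      case False
      then have "z \<in> interior ?K" using z A(3) filled_julia_set_eq_Un(1)[OF deg] by blast
      from near[OF this z] show ?thesis
        by eventually_elim (use e in auto)
    qed
  qed (use A in auto)
qed

section \<open>Superattracting cycles and preimages in the interior\<close>

text \<open>With derivative 0, \<open>f\<close> at least halves the distance to \<open>c\<close>
  nearby, so small balls are forward invariant.\<close>

lemma superattracting_ball:
  fixes f :: "complex \<Rightarrow> complex"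
  assumes f: "(f has_field_derivative 0) (at c)" "f c = c" and S: "open S" "c \<in> S"
  shows "\<exists>r>0. ball c r \<subseteq> S \<and> (\<forall>y\<in>ball c r. \<forall>n. (f ^^ n) y \<in> ball c r)"
proof -
  have "\<forall>e>0. \<exists>d>0. \<forall>y. cmod (y - c) < d \<longrightarrow> cmod (f y - f c) \<le> e * cmod (y - c)"
    using f(1) unfolding has_field_derivative_def has_derivative_at_alt by simp
  then obtain d where d: "d > 0" "\<And>y. cmod (y - c) < d \<Longrightarrow> cmod (f y - f c) \<le> 1/2 * cmod (y - c)"
    by (metis half_gt_zero zero_less_one)
  obtain e where e: "e > 0" "ball c e \<subseteq> S" using S openE by blast
  define r where "r = min d e"
  have inv: "f y \<in> ball c r" if "y \<in> ball c r" for y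
  proof -
    have y: "cmod (y - c) < r" using that by (simp add: dist_norm norm_minus_commute)
    then have "cmod (f y - c) \<le> 1/2 * cmod (y - c)" using d(2)[of y] f(2) by (simp add: r_def)
    then have "cmod (f y - c) < r" using y norm_ge_zero[of "y - c"] by linarith
    then show ?thesis by (simp add: dist_norm norm_minus_commute)
  qed
  have "(f ^^ n) y \<in> ball c r" if "y \<in> ball c r" for y n
    by (induction n) (use that inv in auto)
  moreover have "r > 0" "ball c r \<subseteq> S" using d e by (auto simp: r_def)
  ultimately show ?thesis by blast
qed

text \<open>Near \<open>c\<close> the iterates of index below \<open>n\<close> miss
  \<open>w\<close>. In a ball invariant under the \<open>n\<close>-th iterate, division of
  \<open>m\<close> by \<open>n\<close> reduces every time to these.\<close>

lemma superattracting_cycle_avoids: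
  fixes p :: "complex poly"
  assumes n: "n \<ge> 1" "(poly p ^^ n) c = c" "((poly p ^^ n) has_field_derivative 0) (at c)"
    and w: "\<And>i. (poly p ^^ i) c \<noteq> w"
  shows "\<exists>D. open D \<and> c \<in> D \<and> (\<forall>y\<in>D. \<forall>m. (poly p ^^ m) y \<noteq> w)"
proof -
  let ?S = "\<Inter>i\<in>{..<n}. (poly p ^^ i) -` (- {w})"
  have "open ?S" by (intro open_INT ballI open_vimage_funpow_poly) auto
  moreover have "c \<in> ?S" using w by auto
  ultimately obtain r where r: "r > 0" "ball c r \<subseteq> ?S"
      "\<forall>y\<in>ball c r. \<forall>k. ((poly p ^^ n) ^^ k) y \<in> ball c r"
    using superattracting_ball[OF n(3,2)] by meson
  have "(poly p ^^ m) y \<noteq> w" if "y \<in> ball c r" for y m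
  proof -
    have "((poly p ^^ n) ^^ (m div n)) y \<in> ?S" using r that by blast
    moreover have "m mod n < n" using n(1) by simp
    ultimately have "(poly p ^^ (m mod n)) (((poly p ^^ n) ^^ (m div n)) y) \<noteq> w" by blast
    moreover have "poly p ^^ m = poly p ^^ (m mod n) \<circ> (poly p ^^ n) ^^ (m div n)"
      by (simp add: funpow_mult funpow_add[symmetric])
    ultimately show ?thesis by simp
  qed
  then show ?thesis using r(1) by (intro exI[of _ "ball c r"]) auto
qed

text \<open>By the Lipschitz bound common to all iterates, the images of a small \<open>N\<close>
  stay small; once one point hits \<open>w\<close>, all of \<open>N\<close> lies in
  \<open>D\<close>.\<close>

lemma equicontinuous_capture:
  assumes deg: "degree p \<ge> 2" and z: "z \<in> interior (filled_julia_set p)" and D: "open D" "w \<in> D"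
  shows "\<exists>N. open N \<and> z \<in> N \<and>
    (\<forall>m. \<forall>x\<in>N. (poly p ^^ m) x = w \<longrightarrow> (\<forall>y\<in>N. (poly p ^^ m) y \<in> D))"
proof -
  obtain d L where dL: "d > 0" "L > 0"
    "\<And>x y n. x \<in> ball z d \<Longrightarrow> y \<in> ball z d \<Longrightarrow>
      cmod ((poly p ^^ n) x - (poly p ^^ n) y) \<le> L * cmod (x - y)"
    using funpow_equi_lipschitz[OF deg z] by blast
  obtain r where r: "r > 0" "ball w r \<subseteq> D" using D openE by blast
  define e where "e = min d (r / (2 * L))"
  have e: "e > 0" "e \<le> d" "L * (2 * e) \<le> r"
    using dL r by (auto simp: e_def min_def field_simps)
  have "(poly p ^^ m) y \<in> D" if xy: "x \<in> ball z e" "(poly p ^^ m) x = w" "y \<in> ball z e" for m x y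
  proof -
    have "cmod (x - y) < 2 * e"
      using xy dist_triangle[of x y z] by (simp add: dist_norm norm_minus_commute)
    then have "L * cmod (x - y) < L * (2 * e)" using dL by (intro mult_strict_left_mono) auto
    moreover have "cmod (w - (poly p ^^ m) y) \<le> L * cmod (x - y)"
      using dL(3)[of x y m] xy e by auto
    ultimately have "dist w ((poly p ^^ m) y) < r" using e by (simp add: dist_norm)
    then show ?thesis using r by auto
  qed
  then show ?thesis using e by (intro exI[of _ "ball z e"]) auto
qed

text \<open>If a point of \<open>N\<close> reaches \<open>w\<close> at time \<open>m\<close>, all of
  \<open>N\<close> is then in \<open>D\<close>, and \<open>w\<close> is not hit from time
  \<open>n1 + m\<close> on.\<close>

lemma preimages_leave_interior:
  assumes deg: "degree p \<ge> 2" and z: "z \<in> interior (filled_julia_set p)"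
    and D: "open D" "w \<in> D" "\<And>y n. y \<in> D \<Longrightarrow> n \<ge> n1 \<Longrightarrow> (poly p ^^ n) y \<noteq> w"
  shows "\<exists>N. open N \<and> z \<in> N \<and> (\<forall>\<^sub>F m in sequentially. {x. (poly p ^^ m) x = w} \<inter> N = {})"
proof -
  obtain N where N: "open N" "z \<in> N"
    "\<And>m x y. x \<in> N \<Longrightarrow> (poly p ^^ m) x = w \<Longrightarrow> y \<in> N \<Longrightarrow> (poly p ^^ m) y \<in> D"
    using equicontinuous_capture[OF deg z D(1,2)] by blast
  show ?thesis
  proof (cases "\<exists>m. \<exists>x\<in>N. (poly p ^^ m) x = w")
    case False
    then have "{x. (poly p ^^ m) x = w} \<inter> N = {}" for m by blast
    then show ?thesis using N by auto
  next
    case True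
    then obtain m x where mx: "x \<in> N" "(poly p ^^ m) x = w" by blast
    have "(poly p ^^ n) y \<noteq> w" if "n \<ge> n1 + m" "y \<in> N" for n y
    proof -
      have "(poly p ^^ (n - m)) ((poly p ^^ m) y) \<noteq> w"
        using that N(3)[OF mx that(2)] by (intro D(3)) auto
      moreover have "poly p ^^ n = poly p ^^ (n - m) \<circ> poly p ^^ m"
        using that by (simp add: funpow_add[symmetric])
      ultimately show ?thesis by simp
    qed
    then have "\<forall>\<^sub>F n in sequentially. {x. (poly p ^^ n) x = w} \<inter> N = {}"
      unfolding eventually_sequentially by blast
    then show ?thesis using N by blast
  qed
qed

lemma finite_preimages:
  fixes p :: "complex poly"
  assumes "degree p \<ge> 1"
  shows "finite {x. (poly p ^^ n) x = w}"
proof -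
  obtain q where q: "poly p ^^ n = poly q" "degree q = degree p ^ n"
    using funpow_poly_conv by blast
  have "q - [:w:] \<noteq> 0"
  proof
    assume "q - [:w:] = 0"
    then have "degree q = 0" by simp
    then show False using q assms by simp
  qed
  then have "finite {x. poly (q - [:w:]) x = 0}" by (rule poly_roots_finite)
  then show ?thesis using q by simp
qed

text \<open>Near \<open>w\<close> the only preimage of \<open>w\<close> is \<open>w\<close> itself,
  and \<open>equicontinuous_capture\<close> spreads this over the interior: a small neighbourhood
  meets \<open>U\<close> only in the finitely many points that are at \<open>w\<close> at one common
  time. Hence \<open>U\<close> accumulates only on the Julia set.\<close>

lemma hausdorff_limit_preimages_superattracting:
  assumes deg: "degree p \<ge> 2"
    and uv: "u \<noteq> v" "(poly p ^^ k) u = w" "(poly p ^^ k) v = w"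
    and w: "poly p w = w" "poly (pderiv p) w = 0"
  defines "U \<equiv> (\<Union>k\<in>{1..}. {x. (poly p ^^ k) x = w})"
  shows "hausdorff_limit (\<lambda>m. {x. (poly p ^^ m) x = w}) (julia_set p \<union> U)" "julia_set p \<inter> U = {}"
proof -
  let ?K = "filled_julia_set p"
  have wn: "(poly p ^^ n) w = w" for n by (induction n) (auto simp: w)
  have mono: "(poly p ^^ n) x = w" if "(poly p ^^ m) x = w" "m \<le> n" for m n x
  proof -
    have "poly p ^^ n = poly p ^^ (n - m) \<circ> poly p ^^ m"
      using that by (simp add: funpow_add[symmetric])
    then show ?thesis using that wn by simp
  qed
  \<comment> \<open>An orbit that stays in \<open>?S\<close> can reach \<open>w\<close> only by
    starting there.\<close>
  let ?S = "- ({x. (poly p ^^ 1) x = w} - {w})"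
  have "closed ({x. (poly p ^^ 1) x = w} - {w})"
    using finite_preimages[of p 1 w] deg by (intro finite_imp_closed) auto
  then have "open ?S" by (rule open_Compl)
  moreover have "(poly p has_field_derivative 0) (at w)"
    using poly_DERIV[of p w] w by simp
  ultimately obtain r where r: "r > 0" "ball w r \<subseteq> ?S" "\<And>y n. y \<in> ball w r \<Longrightarrow> (poly p ^^ n) y \<in> ball w r"
    using superattracting_ball[of "poly p" w ?S] w by auto
  have "y \<in> ?K" if "y \<in> ball w r" for y
    unfolding filled_julia_set_def
    using r(3)[OF that] by (auto intro!: bounded_subset[OF bounded_ball[of w r]])
  then have wK: "w \<in> interior ?K" using r(1) by (meson centre_in_ball interiorI open_ball subsetI)
  have hit: "y = w" if "y \<in> ball w r" "(poly p ^^ n) y = w" for y n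
    using that
  proof (induction n)
    case (Suc n)
    have "(poly p ^^ n) y \<in> ?S" using r(2,3) Suc.prems by blast
    then show ?case using Suc by auto
  qed simp
  have U_int: "U \<subseteq> interior ?K"
  proof
    fix x assume "x \<in> U"
    then obtain k where "(poly p ^^ k) x = w" by (auto simp: U_def)
    then show "x \<in> interior ?K"
      using wK funpow_in_interior_filled_julia_set_iff[OF deg, of k x] by simp
  qed
  then show disj: "julia_set p \<inter> U = {}" using filled_julia_set_eq_Un(2)[OF deg] by blast
  \<comment> \<open>Time 0 is covered because \<open>w\<close> is fixed: an orbit at
    \<open>w\<close> at time \<open>m\<close> is there at \<open>Suc m\<close> too.\<close>
  have U_iff: "x \<in> U \<longleftrightarrow> (\<exists>m. (poly p ^^ m) x = w)" for x
  proof
    assume "\<exists>m. (poly p ^^ m) x = w"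
    then obtain m where "(poly p ^^ m) x = w" ..
    then have "(poly p ^^ Suc m) x = w" by (rule mono) simp
    then show "x \<in> U" unfolding U_def by (intro UN_I[of "Suc m"]) auto
  qed (auto simp: U_def)
  have isolated: "\<exists>N. open N \<and> z \<in> N \<and> N \<subseteq> interior ?K \<and> N \<inter> U = {}"
    if z: "z \<in> interior ?K" "z \<notin> U" for z
  proof -
    obtain N where N: "open N" "z \<in> N"
      "\<And>m x y. x \<in> N \<Longrightarrow> (poly p ^^ m) x = w \<Longrightarrow> y \<in> N \<Longrightarrow> (poly p ^^ m) y \<in> ball w r"
      using equicontinuous_capture[OF deg z(1), of "ball w r" w] r(1) by auto
    have "\<exists>m. N \<inter> U \<subseteq> {x. (poly p ^^ m) x = w}"
    proof (cases "N \<inter> U = {}")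
      case False
      then obtain x where x: "x \<in> N" "x \<in> U" by blast
      then obtain m where m: "(poly p ^^ m) x = w" using U_iff by blast
      have "(poly p ^^ m) y = w" if "y \<in> N" "(poly p ^^ n) y = w" for y n
      proof -
        have "(poly p ^^ (n + m)) y = w" using that mono by simp
        then have "(poly p ^^ n) ((poly p ^^ m) y) = w" by (simp add: funpow_add)
        then show ?thesis using hit N(3)[OF x(1) m that(1)] by blast
      qed
      then have "N \<inter> U \<subseteq> {x. (poly p ^^ m) x = w}" using U_iff by blast
      then show ?thesis ..
    qed auto
    then have "finite (N \<inter> U)"
      using finite_preimages deg finite_subset by (metis Suc_1 Suc_leD One_nat_def)
    then have "open (N \<inter> interior ?K - N \<inter> U)"
      using N by (intro open_Diff open_Int finite_imp_closed) auto
    then show ?thesis using z N by (intro exI[of _ "N \<inter> interior ?K - N \<inter> U"]) auto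
  qed
  show "hausdorff_limit (\<lambda>m. {x. (poly p ^^ m) x = w}) (julia_set p \<union> U)"
  proof (rule hausdorff_limit_preimages[OF deg uv])
    have "open (- (julia_set p \<union> U))"
    proof (subst open_subopen, rule ballI)
      fix z assume z: "z \<in> - (julia_set p \<union> U)"
      show "\<exists>T. open T \<and> z \<in> T \<and> T \<subseteq> - (julia_set p \<union> U)"
      proof (cases "z \<in> ?K")
        case True
        then have "z \<in> interior ?K" "z \<notin> U" using z filled_julia_set_eq_Un(1)[OF deg] by auto
        then obtain N where N: "open N" "z \<in> N" "N \<subseteq> interior ?K" "N \<inter> U = {}"
          using isolated by blast
        then have "N \<subseteq> - (julia_set p \<union> U)" using filled_julia_set_eq_Un(2)[OF deg] by blast
        then show ?thesis using N by blast
      next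
        case False
        have "open (- ?K)" using compact_imp_closed[OF compact_filled_julia_set[OF deg]] by (simp add: open_Compl)
        moreover have "- ?K \<subseteq> - (julia_set p \<union> U)"
          using U_int filled_julia_set_eq_Un(1)[OF deg] by blast
        ultimately show ?thesis using False by blast
      qed
    qed
    then show "closed (julia_set p \<union> U)" by (simp add: closed_def)
    show "julia_set p \<union> U \<subseteq> ?K"
      using U_int filled_julia_set_eq_Un(1)[OF deg] by blast
    show "\<exists>N. open N \<and> z \<in> N \<and> (\<forall>\<^sub>F m in sequentially. {x. (poly p ^^ m) x = w} \<inter> N = {})"
      if z: "z \<in> interior ?K" "z \<notin> julia_set p \<union> U" for z
    proof -
      obtain N where N: "open N" "z \<in> N" "N \<inter> U = {}" using isolated z by blast
      then have "{x. (poly p ^^ m) x = w} \<inter> N = {}" for m using U_iff by blast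
      then show ?thesis using N by auto
    qed
    show "\<forall>\<^sub>F m in sequentially. (poly p ^^ m) z = w"
      if z: "z \<in> interior ?K" "z \<in> julia_set p \<union> U" for z
    proof -
      obtain n where "(poly p ^^ n) z = w"
        using z filled_julia_set_eq_Un(2)[OF deg] U_iff by blast
      then show ?thesis using mono unfolding eventually_sequentially by blast
    qed
  qed auto
qed

section \<open>Exceptional points\<close>

lemma poly_with_unique_root:
  fixes f :: "complex poly"
  assumes "f \<noteq> 0" "\<And>x. poly f x = 0 \<Longrightarrow> x = r"
  shows "f = smult (lead_coeff f) ([:- r, 1:] ^ degree f)"
proof -
  obtain A where A: "size A = degree f" "f = smult (lead_coeff f) (\<Prod>x\<in>#A. [:- x, 1:])"
    using alg_closed_imp_factorization[OF assms(1)] by blast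
  have "x = r" if "x \<in># A" for x
  proof -
    have "[:- x, 1:] dvd (\<Prod>x\<in>#A. [:- x, 1:])" using that by (intro dvd_prod_mset) auto
    then have "[:- x, 1:] dvd f" using A(2) by (metis dvd_smult)
    then show ?thesis using assms(2) by (simp add: poly_eq_0_iff_dvd)
  qed
  then have "A = replicate_mset (degree f) r"
    using A(1) by (metis set_mset_subset_singletonD singletonI subsetI)
  then show ?thesis using A(2) by (metis image_replicate_mset prod_mset_replicate_mset)
qed

text \<open>
  If \<open>w\<close> and its preimage \<open>r\<close> both have a single preimage, then \<open>p - w = a (z - r)\<^sup>d\<close> and
  \<open>p - r = a (z - t)\<^sup>d\<close>, and equating the derivatives gives \<open>t = r\<close>, hence \<open>r = w\<close>.
\<close>

lemma exceptional_point:
  fixes p :: "complex poly"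
  assumes deg: "degree p \<ge> 2"
    and exc: "\<And>k u v. (poly p ^^ k) u = w \<Longrightarrow> (poly p ^^ k) v = w \<Longrightarrow> u = v"
  shows "p = smult (lead_coeff p) ([:- w, 1:] ^ degree p) + [:w:]"
proof -
  have factor: "p - [:s:] = smult (lead_coeff p) ([:- r, 1:] ^ degree p)"
    if "\<And>x. poly p x = s \<Longrightarrow> x = r" for s r
  proof -
    have dg: "degree (p - [:s:]) = degree p"
      using deg degree_add_eq_left[of "- [:s:]" p] by (simp del: minus_pCons)
    have "lead_coeff (p - [:s:]) = lead_coeff p"
      using deg unfolding dg by (simp add: coeff_pCons split: nat.splits)
    moreover have "p - [:s:] \<noteq> 0" using dg deg by auto
    ultimately show ?thesis
      using poly_with_unique_root[of "p - [:s:]" r] that unfolding dg by auto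
  qed
  obtain r where r: "poly p r = w" using funpow_poly_surj[of p 1 w] deg by auto
  obtain t where t: "poly p t = r" using funpow_poly_surj[of p 1 r] deg by auto
  have 1: "p - [:w:] = smult (lead_coeff p) ([:- r, 1:] ^ degree p)"
    using exc[of 1] r by (intro factor) simp
  have 2: "p - [:r:] = smult (lead_coeff p) ([:- t, 1:] ^ degree p)"
    using exc[of 2] r t by (intro factor) (simp add: numeral_2_eq_2)
  obtain d where d: "degree p = Suc (Suc d)" using deg by (metis add_2_eq_Suc le_Suc_ex)
  have "pderiv (p - [:w:]) = pderiv (p - [:r:])"
    by (simp add: pderiv_diff pderiv_pCons)
  then have "poly (pderiv (p - [:w:])) r = poly (pderiv (p - [:r:])) r" by simp
  then have "lead_coeff p * (of_nat (degree p) * (r - t) ^ Suc d) = 0"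
    unfolding 1 2 d by (simp add: pderiv_smult pderiv_power_Suc pderiv_pCons del: power_Suc)
  then have "r = t" using deg by auto
  then have "w = r" using r t by simp
  then show ?thesis using 1 by (simp add: algebra_simps)
qed

section \<open>Cubic independence polynomials\<close>

text \<open>Since \<open>x\<close> divides \<open>f x\<close>, the value \<open>f (- 1)\<close>
  divides the return value -1 and is a unit. It is not 1, because the orbit of 1 stays
  positive.\<close>

lemma int_poly_periodic_point_m1:
  fixes a b c :: int
  assumes nonneg: "a > 0" "b \<ge> 0" "c \<ge> 0"
    and per: "n \<ge> 1" "((\<lambda>x. a * x + b * x\<^sup>2 + c * x ^ 3) ^^ n) (- 1) = - 1"
  shows "- a + b - c = - 1"
proof -
  define f where "f x = a * x + b * x\<^sup>2 + c * x ^ 3" for x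
  have dvd: "x dvd (f ^^ n) x" for n x
  proof (induction n)
    case (Suc n)
    have "y dvd f y" for y unfolding f_def by (intro dvd_add) (auto simp: power2_eq_square power3_eq_cube)
    then show ?case using Suc dvd_trans by auto
  qed simp
  have pos: "(f ^^ n) 1 > 0" for n
  proof (induction n)
    case (Suc n)
    then show ?case using nonneg by (simp add: f_def add_pos_nonneg)
  qed simp
  obtain k where k: "n = Suc k" using per by (cases n) auto
  have "f = (\<lambda>x. a * x + b * x\<^sup>2 + c * x ^ 3)" by (simp add: f_def[abs_def])
  then have "(f ^^ Suc k) (- 1) = - 1" using per(2) by (simp only: k)
  then have "(f ^^ k) (f (- 1)) = - 1" by (simp add: funpow_Suc_right del: funpow.simps)
  then have "f (- 1) dvd - 1" "f (- 1) \<noteq> 1"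
    using dvd[of "f (- 1)" k] pos[of k] by auto
  then have "f (- 1) = - 1" by (simp add: zdvd1_eq)
  then show ?thesis by (simp add: f_def)
qed

lemma hausdorff_limit_singleton: "hausdorff_limit (\<lambda>_. {x}) {x :: complex}"
  by (rule hausdorff_limitI[of "{x}"]) auto

text \<open>Otherwise -1 is exceptional and the cubic is a3 (z + 1)^3 - 1; its zero constant term
  forces \<open>a3 = 1\<close>, hence the excluded coefficients.\<close>

lemma cubic_preimages_m1_distinct:
  fixes a1 a2 a3 :: nat
  assumes a3: "a3 \<ge> 1" and not: "\<not> (a1 = 3 \<and> a2 = 3 \<and> a3 = 1)"
  defines "p \<equiv> [:0, of_nat a1, of_nat a2, of_nat a3:] :: complex poly"
  shows "\<exists>u v k. u \<noteq> v \<and> (poly p ^^ k) u = - 1 \<and> (poly p ^^ k) v = - 1"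
proof (rule ccontr)
  assume "\<not> ?thesis"
  moreover have deg: "degree p = 3" "lead_coeff p = of_nat a3" using a3 by (auto simp: p_def)
  ultimately have "p = smult (of_nat a3) ([:1, 1:] ^ 3) + [:- 1:]"
    using exceptional_point[of p "- 1"] by auto
  then have "[:0, of_nat a1, of_nat a2, of_nat a3:]
      = [:of_nat a3 - 1, 3 * of_nat a3, 3 * of_nat a3, of_nat a3 :: complex:]"
    unfolding p_def by (simp add: power3_eq_cube)
  then have "of_nat a3 = (1 :: complex)" "of_nat a1 = (of_nat (3 * a3) :: complex)"
      "of_nat a2 = (of_nat (3 * a3) :: complex)"
    by simp_all
  then show False using not unfolding of_nat_eq_iff of_nat_eq_1_iff by simp
qed

text \<open>Each interior point needs a neighbourhood that is eventually free of preimages of -1. If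
  -1 is interior, its orbit ends in a superattracting integer cycle, and \<open>not\<close> keeps -1
  off that cycle.\<close>

lemma cubic_attractor_eq_julia_set:
  fixes a1 a2 a3 :: nat
  assumes a3: "a3 \<ge> 1" "a1 \<ge> 1"
    and not: "\<not> (a1 \<ge> 3 \<and> int a2 = 2 * int a1 - 3 \<and> int a3 = int a1 - 2)"
  defines "p \<equiv> [:0, of_nat a1, of_nat a2, of_nat a3:] :: complex poly"
  shows "hausdorff_limit (\<lambda>m. {x. (poly p ^^ m) x = - 1}) (julia_set p)"
proof -
  let ?K = "filled_julia_set p"
  have deg: "degree p \<ge> 2" using a3 by (simp add: p_def)
  have int: "coeff p i \<in> \<int>" for i
    by (auto simp: p_def coeff_pCons split: nat.splits)
  have p_of_int: "(poly p ^^ n) (of_int x)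
      = of_int (((\<lambda>x. int a1 * x + int a2 * x\<^sup>2 + int a3 * x ^ 3) ^^ n) x)" for n x
    by (induction n) (auto simp: p_def algebra_simps power2_eq_square power3_eq_cube)
  obtain u v k where uv: "u \<noteq> v" "(poly p ^^ k) u = - 1" "(poly p ^^ k) v = - 1"
    using cubic_preimages_m1_distinct[of a3 a1 a2] a3 not unfolding p_def by auto
  have away: "\<exists>N. open N \<and> z \<in> N \<and> (\<forall>\<^sub>F m in sequentially. {x. (poly p ^^ m) x = - 1} \<inter> N = {})"
    if z: "z \<in> interior ?K" for z
  proof (cases "- 1 \<in> interior ?K")
    case False
    then have "(poly p ^^ m) x \<noteq> - 1" if "x \<in> interior ?K" for m x
      using funpow_in_interior_filled_julia_set_iff[OF deg, of m x] that by metis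
    then have "{x. (poly p ^^ m) x = - 1} \<inter> interior ?K = {}" for m by blast
    then show ?thesis using z by (intro exI[of _ "interior ?K"]) auto
  next
    case True
    obtain R where R: "escape_radius p R" using escape_radius_exists deg by blast
    have "- 1 \<in> ?K" using True interior_subset by blast
    \<comment> \<open>A bounded orbit of integers takes finitely many values, so it repeats at times
      \<open>i < j\<close>; \<open>c\<close> is the repeated value and returns after
      \<open>n = j - i\<close> steps.\<close>
    have "range (\<lambda>n. (poly p ^^ n) (- 1)) \<subseteq> of_int ` {- \<lceil>R\<rceil>..\<lceil>R\<rceil>}"
    proof (rule image_subsetI)
      fix n
      obtain x where x: "(poly p ^^ n) (- 1) = of_int x" using p_of_int[of n "- 1"] by simp
      have "cmod ((poly p ^^ n) (- 1)) \<le> R" using \<open>- 1 \<in> ?K\<close> by (simp add: filled_julia_set_eq[OF R])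
      then have "\<bar>of_int x\<bar> \<le> R" by (simp add: x norm_of_int)
      then have "x \<in> {- \<lceil>R\<rceil>..\<lceil>R\<rceil>}" by (auto simp: abs_le_iff; linarith)
      then show "(poly p ^^ n) (- 1) \<in> of_int ` {- \<lceil>R\<rceil>..\<lceil>R\<rceil>}" by (simp add: x)
    qed
    then have "finite (range (\<lambda>n. (poly p ^^ n) (- 1)))" by (rule finite_subset) auto
    then have "\<not> inj (\<lambda>n. (poly p ^^ n) (- 1))" using finite_imageD infinite_UNIV_nat by blast
    then obtain i j where ij: "i < j" "(poly p ^^ i) (- 1) = (poly p ^^ j) (- 1)"
      unfolding inj_def by (metis nat_neq_iff)
    define c where "c = (poly p ^^ j) (- 1)"
    define n where "n = j - i"
    have n1: "n \<ge> 1" using ij by (simp add: n_def)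
    have "poly p ^^ j = poly p ^^ n \<circ> poly p ^^ i"
      using ij by (simp add: n_def funpow_add[symmetric])
    then have cn: "(poly p ^^ n) c = c" using ij(2) by (simp add: c_def)
    have cK: "c \<in> interior ?K" and cZ: "c \<in> \<int>"
      using True funpow_in_interior_filled_julia_set_iff[OF deg] funpow_poly_int_derivative[OF int, of "- 1" j]
      by (auto simp: c_def)
    \<comment> \<open>Otherwise -1 would be periodic, hence fixed with multiplier 0. The two
      resulting linear equations give the excluded values of \<open>a2\<close> and
      \<open>a3\<close>, and \<open>a3 \<ge> 1\<close> then gives \<open>a1 \<ge> 3\<close>.\<close>
    have "(poly p ^^ m) c \<noteq> - 1" for m
    proof
      assume "(poly p ^^ m) c = - 1"
      then have "(poly p ^^ (m + j)) (- 1) = - 1" by (simp add: c_def funpow_add)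
      then have "of_int (((\<lambda>x. int a1 * x + int a2 * x\<^sup>2 + int a3 * x ^ 3) ^^ (m + j)) (- 1)) = (of_int (- 1) :: complex)"
        using p_of_int[of "m + j" "- 1"] by simp
      then have eq1: "- int a1 + int a2 - int a3 = - 1"
        using ij a3 unfolding of_int_eq_iff by (intro int_poly_periodic_point_m1[of _ _ _ "m + j"]) auto
      then have "of_int (- int a1 + int a2 - int a3) = (of_int (- 1) :: complex)" by simp
      then have fixed: "poly p (- 1) = - 1" by (simp add: p_def algebra_simps)
      have "((poly p ^^ 1) has_field_derivative 0) (at (- 1))"
        using fixed True by (intro int_multiplier_zero deg int) auto
      then have "poly (pderiv p) (- 1) = 0"
        using DERIV_unique poly_DERIV by fastforce
      then have "of_int (int a1 - 2 * int a2 + 3 * int a3) = (of_int 0 :: complex)"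
        by (simp add: p_def pderiv_pCons algebra_simps)
      then have "int a1 - 2 * int a2 + 3 * int a3 = 0" unfolding of_int_eq_iff .
      then show False using eq1 not a3 by auto
    qed
    then obtain D where D: "open D" "c \<in> D" "\<forall>y\<in>D. \<forall>m. (poly p ^^ m) y \<noteq> - 1"
      using superattracting_cycle_avoids[OF n1 cn int_multiplier_zero[OF deg int cK cZ n1 cn]] by blast
    show ?thesis
    \<comment> \<open>Points that lie in \<open>D\<close> after \<open>j\<close> steps form a
      neighbourhood of -1 and do not hit -1 from time \<open>j\<close> on.\<close>
    proof (rule preimages_leave_interior[OF deg z])
      show "open ((poly p ^^ j) -` D)" by (intro open_vimage_funpow_poly D)
      show "- 1 \<in> (poly p ^^ j) -` D" using D by (simp add: c_def)
      show "(poly p ^^ m) y \<noteq> - 1" if "y \<in> (poly p ^^ j) -` D" "m \<ge> j" for y m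
      proof -
        have "poly p ^^ m = poly p ^^ (m - j) \<circ> poly p ^^ j"
          using that by (simp add: funpow_add[symmetric])
        then show ?thesis using D that by simp
      qed
    qed
  qed
  show ?thesis
    by (rule hausdorff_limit_preimages[OF deg uv])
      (use compact_imp_closed[OF compact_julia_set[OF deg]] filled_julia_set_eq_Un[OF deg] away in blast)+
qed

text \<open>The first conjunct ensures that the definite description in
  \<open>independence_attractor\<close> denotes the limit. The premise
  \<open>parcs G \<noteq> {}\<close> excludes the edgeless graph, where \<open>C\<close> holds but
  the attractor is a single point. Equations over \<open>int\<close> avoid truncated
  subtraction.\<close>

theorem theorem1p5:
  fixes G :: "'a pair_pre_digraph" and a1 a2 a3 :: nat
  assumes "pair_graph G"
    and "independence_poly G = [:1, of_nat a1, of_nat a2, of_nat a3:]"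
    and "a3 \<ge> 1"
  defines "P \<equiv> independence_poly G - 1"
    and "U \<equiv> (\<Union>k\<in>{1..}. roots (independence_poly (lex_power G k)))"
    and "C \<equiv> a1 \<ge> 3 \<and> int a2 = 2 * int a1 - 3 \<and> int a3 = int a1 - 2"
  shows "hausdorff_limit (\<lambda>m. roots (independence_poly (lex_power G m))) (independence_attractor G) \<and>
    (parcs G \<noteq> {} \<longrightarrow>
       ((independence_attractor G = julia_set P \<union> U \<and> julia_set P \<inter> U = {}) \<longleftrightarrow> C)) \<and>
    (\<not> C \<longrightarrow> independence_attractor G = julia_set P)"
proof -
  interpret pair_graph G by fact
  have fin: "finite (pverts G)" by simp
  have P: "P = [:0, of_nat a1, of_nat a2, of_nat a3:]"
    by (simp add: P_def assms(2) one_pCons)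
  have deg: "degree P \<ge> 2" using assms(3) by (simp add: P)
  let ?X = "\<lambda>m. {x. (poly P ^^ m) x = - 1}"
  have X: "roots (independence_poly (lex_power G m)) = ?X m" for m
    by (auto simp: roots_def poly_independence_poly_lex_power[OF fin] P_def eq_neg_iff_add_eq_0)
  have U: "U = (\<Union>k\<in>{1..}. ?X k)" by (simp add: U_def X)
  have attractor: "independence_attractor G = A" if "hausdorff_limit ?X A" for A
    unfolding independence_attractor_def X using that by (rule the_hausdorff_limit)
  have coeffs: "num_independent_sets G 1 = a1" "num_independent_sets G 3 = a3"
    using coeff_independence_poly[OF fin, of 1] coeff_independence_poly[OF fin, of 3]
    by (simp_all add: assms(2) numeral_3_eq_3)
  \<comment> \<open>A nonempty \<open>U\<close> rules out the disjoint union when the attractor is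
    the Julia set alone.\<close>
  have "?X 1 \<noteq> {}" using funpow_poly_surj[of P 1 "- 1"] deg by auto
  then have U_ne: "U \<noteq> {}" unfolding U by fastforce
  have a1: "a1 \<ge> 1"
  proof -
    have "{S. independent_set G S \<and> card S = 3} \<noteq> {}"
      using coeffs(2) assms(3) by (force simp: num_independent_sets_def)
    then obtain S where "S \<subseteq> pverts G" "card S = 3" by (auto simp: independent_set_def)
    then have "3 \<le> card (pverts G)" using card_mono[OF fin] by metis
    then show ?thesis using coeffs(1) num_independent_sets_1[OF assms(1)] by simp
  qed
  consider (generic) "\<not> C" | (edgeless) "C" "a1 = 3" | (superattracting) "C" "a1 \<noteq> 3" by blast
  then show ?thesis
  proof cases
    case generic
    then have lim: "hausdorff_limit ?X (julia_set P)"
      using cubic_attractor_eq_julia_set[OF assms(3) a1, of a2] unfolding C_def P by blast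
    then show ?thesis using generic U_ne unfolding X attractor[OF lim] by blast
  next
    case edgeless
    then have a: "a1 = 3" "a2 = 3" "a3 = 1" by (auto simp: C_def)
    have "poly P x = (x + 1) ^ 3 - 1" for x by (simp add: P a power3_eq_cube algebra_simps)
    then have P_iff: "poly P x = - 1 \<longleftrightarrow> x = - 1" for x by (simp add: eq_neg_iff_add_eq_0)
    have "(poly P ^^ m) x = - 1 \<longleftrightarrow> x = - 1" for m x
      by (induction m) (simp_all add: P_iff)
    then have "?X m = {- 1}" for m by simp
    then have lim: "hausdorff_limit ?X {- 1}" using hausdorff_limit_singleton by simp
    have "parcs G = {}"
      using edgeless_if_independent_set_card_pverts[OF assms(1)] num_independent_sets_1[OF assms(1)] coeffs a
      by simp
    then show ?thesis using lim edgeless unfolding X attractor[OF lim] by blast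
  next
    case superattracting
    then have "int a2 = 2 * int a1 - 3" "int a3 = int a1 - 2" by (auto simp: C_def)
    then have a: "of_nat a2 = 2 * of_nat a1 - (3 :: complex)" "of_nat a3 = of_nat a1 - (2 :: complex)"
      by (metis of_int_diff of_int_mult of_int_numeral of_int_of_nat_eq)+
    obtain u v k where uv: "u \<noteq> v" "(poly P ^^ k) u = - 1" "(poly P ^^ k) v = - 1"
      using cubic_preimages_m1_distinct[of a3 a1 a2] assms(3) superattracting(2) unfolding P by blast
    \<comment> \<open>The equations in \<open>C\<close> make -1 a superattracting fixed point of
      \<open>P\<close>.\<close>
    have "poly P (- 1) = - 1" "poly (pderiv P) (- 1) = 0"
      by (simp_all add: P a pderiv_pCons algebra_simps)
    from hausdorff_limit_preimages_superattracting[OF deg uv this]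
    have lim: "hausdorff_limit ?X (julia_set P \<union> U)" and "julia_set P \<inter> U = {}"
      unfolding U by auto
    then show ?thesis using superattracting unfolding X attractor[OF lim] by blast
  qed
qed

end
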